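(* Let $m\ge2$, $n\ge1$ and let $\mathbb{T}=(t_{i_1\cdots i_m})$ be a tensor of order $m$ and dimension $n$ over $\mathbb{C}$. Then $$\begin{aligned}\frac{Tr_3(\mathbb{T})}{(m-1)^{n-1}}=\ &\sum_{i=1}^n t_{ii\cdots i}^3\\ &+\sum_{i\ne j}\sum_{s=0}^{m-1}\frac{3s}{2(m-1)}\Big(\sum_{\{i_2,\dots,i_m,k_2,\dots,k_m\}=j^si^{2(m-1)-s}}t_{ii_2\cdots i_m}t_{ik_2\cdots k_m}\Big)\Big(\sum_{\{j_2,\dots,j_m\}=i^sj^{m-1-s}}t_{jj_2\cdots j_m}\Big)\\ &+\sum_{i<j<k}\sum_{p=0}^{m-1}\sum_{q=0}^{m-1}\sum_{r=0}^{m-1}\sum_{s=0}^{m-1}\frac{w(m;p,q,r,s)\,t(i,j,k;p,q,r,s)}{\binom{m-1}{s,\ r,\ *}\binom{m-1}{p,\ q+s-p,\ *}\binom{m-1}{q,\ r+s-p,\ *}},\end{aligned}$$ where $i\neq j$ runs over ordered pairs of distinct elements of $\{1,\dots,n\}$, $i<j<k$ runs over triples in $\{1,\dots,n\}$, each $*$ in a multinomial coefficient is the number making the three lower entries sum to $m-1$, and the terms of the last sum with $w(m;p,q,r,s)=0$ are taken to be $0$.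
   Context: Write $[n]=\{1,\dots,n\}$. A tensor $\mathbb{T}$ of order $m$ and dimension $n$ is an array of complex entries $t_{i_1\cdots i_m}$, $i_1,\dots,i_m\in[n]$. Trace: let $A=(a_{ij})$ be an $n\times n$ matrix whose entries are independent variables; for $y=(s_1,\dots,s_{m-1})\in[n]^{m-1}$ put $t_{iy}=t_{is_1\cdots s_{m-1}}$ and $\frac{\partial}{\partial a_{iy}}=\prod_{l=1}^{m-1}\frac{\partial}{\partial a_{is_l}}$. The $d$-th order trace ($d\ge1$) is $$Tr_d(\mathbb{T})=(m-1)^{n-1}\sum_{d_1+\cdots+d_n=d}\ \prod_{i=1}^n\frac{1}{(d_i(m-1))!}\Big(\sum_{y_i\in[n]^{m-1}}t_{iy_i}\frac{\partial}{\partial a_{iy_i}}\Big)^{d_i}\operatorname{tr}(A^{d(m-1)}),$$ the sum being over nonnegative integers $d_1,\dots,d_n$ with sum $d$. Multi-set notation: $a_1^{r_1}\cdots a_s^{r_s}$ denotes the multi-set containing $a_l$ with multiplicity $r_l$. A sum over $\{i_2,\dots,i_m\}=M$ means the sum over all tuples $(i_2,\dots,i_m)\in[n]^{m-1}$ whose multi-set of entries is $M$ (and similarly, a sum over $\{i_2,\dots,i_m,k_2,\dots,k_m\}=M$ is over all pairs of tuples whose combined multi-set of entries is $M$); it is an empty sum, equal to $0$, if $M$ would involve a negative multiplicity. For distinct $i,j,k$ and $0\le p,q,r,s\le m-1$, let $E(i,j,k;p,q,r,s)$ be the multi-set of arcs $$(i,j)^p(j,k)^q(k,i)^r(j,i)^s(i,k)^{r+s-p}(k,j)^{q+s-p}(i,i)^{m-1-s-r}(j,j)^{m-1-s-q}(k,k)^{m-1+p-r-s-q}.$$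 A closed walk of length $l$ is a sequence of vertices $(v_1,\dots,v_l)$ (so the initial vertex is part of the data), with arc multi-set $\{(v_1,v_2),(v_2,v_3),\dots,(v_l,v_1)\}$ counted with multiplicity. $w(m;p,q,r,s)$ is the number of closed walks whose arc multi-set equals $E(i,j,k;p,q,r,s)$ (this number does not depend on the choice of the distinct $i,j,k$), with $w(m;p,q,r,s)=0$ if some exponent above is negative. Finally, $$t(i,j,k;p,q,r,s)=\Big(\sum_{\{i_2,\dots,i_m\}=i^*j^pk^{r+s-p}}t_{ii_2\cdots i_m}\Big)\Big(\sum_{\{j_2,\dots,j_m\}=i^sj^*k^q}t_{jj_2\cdots j_m}\Big)\Big(\sum_{\{k_2,\dots,k_m\}=i^rj^{q+s-p}k^*}t_{kk_2\cdots k_m}\Big),$$ where each $*$ is the number making the total multiplicity equal to $m-1$. The multinomial coefficient is $\binom{N}{a,b,c}=\frac{N!}{a!\,b!\,c!}$ for nonnegative $a,b,c$ with $a+b+c=N$. *)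

theory Defs
  imports Complex_Main "HOL-Library.Poly_Mapping" "HOL-Library.Multiset" "HOL-Library.FuncSet"
    "Jordan_Normal_Form.Matrix"
begin

text \<open>
  A tensor of order \<open>m\<close> and dimension \<open>n\<close> over the complex numbers is a function
  \<open>T :: nat list \<Rightarrow> complex\<close>; the entry with indices \<open>i\<^sub>1, \<dots>, i\<^sub>m\<close> is \<open>T [i\<^sub>1, \<dots>, i\<^sub>m]\<close>.
  Only its values on lists of length \<open>m\<close> with entries in \<open>{1..n}\<close> are ever used.
\<close>

definition tuples :: "nat \<Rightarrow> nat \<Rightarrow> nat list set" where
  "tuples n l = {y. length y = l \<and> set y \<subseteq> {1..n}}"

lemma finite_tuples [simp]: "finite (tuples n l)"
proof -
  have "tuples n l = {y. set y \<subseteq> {1..n} \<and> length y = l}"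
    by (auto simp: tuples_def)
  then show ?thesis
    by (simp add: finite_lists_length_eq)
qed


section \<open>The trace\<close>

text \<open>
  Complex polynomials in variables indexed by \<^typ>\<open>'v\<close>: finitely supported functions from
  monomials (exponent vectors) to coefficients, with the convolution product.
\<close>

type_synonym 'v cpoly = "('v \<Rightarrow>\<^sub>0 nat) \<Rightarrow>\<^sub>0 complex"

definition cpoly_const :: "complex \<Rightarrow> 'v cpoly" where
  "cpoly_const c = Poly_Mapping.single 0 c"

definition cpoly_var :: "'v \<Rightarrow> 'v cpoly" where
  "cpoly_var v = Poly_Mapping.single (Poly_Mapping.single v 1) 1"

text \<open>
  Formal partial derivative. If \<open>v\<close> does not occur in the monomial \<open>\<mu>\<close>, the subtraction of
  exponents truncates, but the coefficient of that summand is then zero.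
\<close>

definition cpoly_deriv :: "'v \<Rightarrow> 'v cpoly \<Rightarrow> 'v cpoly" where
  "cpoly_deriv v P =
     (\<Sum>\<mu>\<in>Poly_Mapping.keys P.
        Poly_Mapping.single (\<mu> - Poly_Mapping.single v 1)
          (of_nat (Poly_Mapping.lookup \<mu> v) * Poly_Mapping.lookup P \<mu>))"

text \<open>The entry of the matrix at the (0-based) position \<open>(i, j)\<close> is the variable \<open>a\<^bsub>i+1,j+1\<^esub>\<close>.\<close>

definition generic_mat :: "nat \<Rightarrow> (nat \<times> nat) cpoly mat" where
  "generic_mat n = mat n n (\<lambda>(i, j). cpoly_var (Suc i, Suc j))"

definition generic_power_trace :: "nat \<Rightarrow> nat \<Rightarrow> (nat \<times> nat) cpoly" where
  "generic_power_trace n k = (\<Sum>v<n. (generic_mat n ^\<^sub>m k) $$ (v, v))"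

text \<open>The operator \<open>\<Sum>\<^sub>y t\<^bsub>iy\<^esub> \<partial>/\<partial>a\<^bsub>iy\<^esub>\<close>.\<close>

definition tensor_op ::
  "nat \<Rightarrow> nat \<Rightarrow> (nat list \<Rightarrow> complex) \<Rightarrow> nat \<Rightarrow> (nat \<times> nat) cpoly \<Rightarrow> (nat \<times> nat) cpoly" where
  "tensor_op n m T i P =
     (\<Sum>y\<in>tuples n (m - 1). cpoly_const (T (i # y)) * foldr (\<lambda>s. cpoly_deriv (i, s)) y P)"

text \<open>
  The summand of the trace for one composition \<open>\<delta>\<close> of \<open>d\<close>, still as a polynomial. The
  operators commute, so the order in which they are composed is immaterial.
\<close>

definition Tr_summand ::
  "nat \<Rightarrow> nat \<Rightarrow> (nat list \<Rightarrow> complex) \<Rightarrow> nat \<Rightarrow> (nat \<Rightarrow> nat) \<Rightarrow> (nat \<times> nat) cpoly" where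
  "Tr_summand n m T d \<delta> =
     foldr (\<lambda>i P. cpoly_const (1 / fact (\<delta> i * (m - 1))) * (tensor_op n m T i ^^ \<delta> i) P)
       [1..<Suc n] (generic_power_trace n (d * (m - 1)))"

text \<open>
  Differentiating \<open>d (m - 1)\<close> times a form of degree \<open>d (m - 1)\<close> yields a constant
  polynomial (lemma \<open>Tr_summand_const\<close> below), which is identified with its constant coefficient.
\<close>

definition Tr :: "nat \<Rightarrow> nat \<Rightarrow> (nat list \<Rightarrow> complex) \<Rightarrow> nat \<Rightarrow> complex" where
  "Tr n m T d =
     of_nat (m - 1) ^ (n - 1) *
     (\<Sum>\<delta> | \<delta> \<in> {1..n} \<rightarrow>\<^sub>E UNIV \<and> (\<Sum>i=1..n. \<delta> i) = d.
        Poly_Mapping.lookup (Tr_summand n m T d \<delta>) 0)"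


section \<open>Multi-sets and closed walks\<close>

text \<open>
  \<open>mset_powers M [(a\<^sub>1, r\<^sub>1), \<dots>, (a\<^sub>s, r\<^sub>s)]\<close> says that \<open>M\<close> is the multi-set
  \<open>a\<^sub>1\<^bsup>r\<^sub>1\<^esup> \<dots> a\<^sub>s\<^bsup>r\<^sub>s\<^esup>\<close>. The exponents are integers; if one of them is negative, no \<open>M\<close> qualifies,
  so sums over (and cardinalities of) such \<open>M\<close> vanish as required.
\<close>

definition mset_powers :: "'a multiset \<Rightarrow> ('a \<times> int) list \<Rightarrow> bool" where
  "mset_powers M ars \<longleftrightarrow>
     (\<forall>(a, r)\<in>set ars. 0 \<le> r) \<and> M = (\<Sum>(a, r)\<leftarrow>ars. replicate_mset (nat r) a)"

definition closed_walk_arcs :: "'a list \<Rightarrow> ('a \<times> 'a) multiset" where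
  "closed_walk_arcs vs = mset (zip vs (rotate1 vs))"

definition E_powers ::
  "nat \<Rightarrow> 'a \<Rightarrow> 'a \<Rightarrow> 'a \<Rightarrow> int \<Rightarrow> int \<Rightarrow> int \<Rightarrow> int \<Rightarrow> (('a \<times> 'a) \<times> int) list" where
  "E_powers m i j k p q r s =
     [((i, j), p), ((j, k), q), ((k, i), r), ((j, i), s),
      ((i, k), r + s - p), ((k, j), q + s - p),
      ((i, i), int m - 1 - s - r), ((j, j), int m - 1 - s - q),
      ((k, k), int m - 1 + p - r - s - q)]"

definition walks_with_arcs :: "(('a \<times> 'a) \<times> int) list \<Rightarrow> 'a list set" where
  "walks_with_arcs E = {vs. mset_powers (closed_walk_arcs vs) E}"

text \<open>
  The number of walks does not depend on the choice of distinct vertices \<open>i, j, k\<close>, see lemma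
  \<open>w_eq\<close> below; the definition uses \<open>1, 2, 3\<close>.
\<close>

definition w :: "nat \<Rightarrow> nat \<Rightarrow> nat \<Rightarrow> nat \<Rightarrow> nat \<Rightarrow> nat" where
  "w m p q r s = card (walks_with_arcs (E_powers m (1::nat) 2 3 (int p) (int q) (int r) (int s)))"


section \<open>Sums of tensor entries\<close>

definition entry_sum ::
  "nat \<Rightarrow> nat \<Rightarrow> (nat list \<Rightarrow> complex) \<Rightarrow> nat \<Rightarrow> (nat \<times> int) list \<Rightarrow> complex" where
  "entry_sum n m T i M = (\<Sum>y | y \<in> tuples n (m - 1) \<and> mset_powers (mset y) M. T (i # y))"

definition entry_pair_sum ::
  "nat \<Rightarrow> nat \<Rightarrow> (nat list \<Rightarrow> complex) \<Rightarrow> nat \<Rightarrow> (nat \<times> int) list \<Rightarrow> complex" where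
  "entry_pair_sum n m T i M =
     (\<Sum>(y, z) | y \<in> tuples n (m - 1) \<and> z \<in> tuples n (m - 1) \<and> mset_powers (mset y + mset z) M.
        T (i # y) * T (i # z))"

definition t3 ::
  "nat \<Rightarrow> nat \<Rightarrow> (nat list \<Rightarrow> complex) \<Rightarrow> nat \<Rightarrow> nat \<Rightarrow> nat \<Rightarrow> int \<Rightarrow> int \<Rightarrow> int \<Rightarrow> int \<Rightarrow> complex" where
  "t3 n m T i j k p q r s =
     entry_sum n m T i [(i, int m - 1 - (p + (r + s - p))), (j, p), (k, r + s - p)] *
     entry_sum n m T j [(i, s), (j, int m - 1 - (s + q)), (k, q)] *
     entry_sum n m T k [(i, r), (j, q + s - p), (k, int m - 1 - (r + (q + s - p)))]"

text \<open>The multinomial coefficient with lower entries \<open>a\<close>, \<open>b\<close>, \<open>N - a - b\<close>, for \<open>a + b \<le> N\<close>.\<close>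

definition trinomial :: "nat \<Rightarrow> nat \<Rightarrow> nat \<Rightarrow> complex" where
  "trinomial N a b = fact N / (fact a * fact b * fact (N - a - b))"


section \<open>Well-definedness\<close>

subsection \<open>The number of closed walks\<close>

lemma mset_powers_image:
  assumes "mset_powers M ars"
  shows "mset_powers (image_mset f M) (map (\<lambda>(a, r). (f a, r)) ars)"
proof -
  have "image_mset f (\<Sum>(a, r)\<leftarrow>ars. replicate_mset (nat r) a)
      = (\<Sum>(a, r)\<leftarrow>map (\<lambda>(a, r). (f a, r)) ars. replicate_mset (nat r) a)" for ars
    by (induction ars) auto
  then show ?thesis
    using assms by (auto simp: mset_powers_def)
qed

lemma set_mset_powers:
  assumes "mset_powers M ars"
  shows "set_mset M \<subseteq> fst ` set ars"
proof -
  have "set_mset (\<Sum>(a, r)\<leftarrow>ars. replicate_mset (nat r) a) \<subseteq> fst ` set ars" for ars :: "('a \<times> int) list"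
    by (induction ars) (auto split: if_splits)
  then show ?thesis
    using assms by (simp add: mset_powers_def)
qed

lemma size_closed_walk_arcs [simp]: "size (closed_walk_arcs vs) = length vs"
  by (simp add: closed_walk_arcs_def)

lemma image_fst_closed_walk_arcs: "image_mset fst (closed_walk_arcs vs) = mset vs"
  by (simp add: closed_walk_arcs_def flip: mset_map)

lemma closed_walk_arcs_map:
  "closed_walk_arcs (map f vs) = image_mset (map_prod f f) (closed_walk_arcs vs)"
  by (simp add: closed_walk_arcs_def rotate1_map zip_map_map map_prod_def flip: mset_map)

lemma walks_with_arcs_vertices:
  assumes "vs \<in> walks_with_arcs E"
  shows "set vs \<subseteq> fst ` fst ` set E"
proof -
  have "set vs = fst ` set_mset (closed_walk_arcs vs)"
    by (metis image_fst_closed_walk_arcs set_image_mset set_mset_mset)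
  then show ?thesis
    using assms set_mset_powers unfolding walks_with_arcs_def by blast
qed

lemma finite_walks_with_arcs: "finite (walks_with_arcs E)"
proof (rule finite_subset)
  let ?l = "size (\<Sum>(a, r)\<leftarrow>E. replicate_mset (nat r) a)"
  show "walks_with_arcs E \<subseteq> {vs. set vs \<subseteq> fst ` fst ` set E \<and> length vs = ?l}"
  proof safe
    fix vs assume vs: "vs \<in> walks_with_arcs E"
    then have "closed_walk_arcs vs = (\<Sum>(a, r)\<leftarrow>E. replicate_mset (nat r) a)"
      by (simp add: walks_with_arcs_def mset_powers_def)
    then show "length vs = ?l"
      by (metis size_closed_walk_arcs)
    show "x \<in> fst ` fst ` set E" if "x \<in> set vs" for x
      using that walks_with_arcs_vertices[OF vs] by blast
  qed
  show "finite {vs. set vs \<subseteq> fst ` fst ` set E \<and> length vs = ?l}"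
    by (simp add: finite_lists_length_eq)
qed

lemma card_walks_E_le:
  fixes i j k :: 'a and i' j' k' :: 'b
  assumes "i \<noteq> j" "i \<noteq> k" "j \<noteq> k" and "i' \<noteq> j'" "i' \<noteq> k'" "j' \<noteq> k'"
  shows "card (walks_with_arcs (E_powers m i j k p q r s))
       \<le> card (walks_with_arcs (E_powers m i' j' k' p q r s))"
proof (rule card_inj_on_le)
  let ?f = "\<lambda>x. if x = i then i' else if x = j then j' else k'"
  have verts: "set vs \<subseteq> {i, j, k}" if "vs \<in> walks_with_arcs (E_powers m i j k p q r s)" for vs
    using walks_with_arcs_vertices[OF that] by (auto simp: E_powers_def)
  show "inj_on (map ?f) (walks_with_arcs (E_powers m i j k p q r s))"
  proof (rule inj_on_subset[OF inj_on_mapI])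
    show "inj_on ?f (\<Union>(set ` lists {i, j, k}))"
      by (rule inj_on_subset[of _ "{i, j, k}"]) (use assms in \<open>auto simp: inj_on_def\<close>)
    show "walks_with_arcs (E_powers m i j k p q r s) \<subseteq> lists {i, j, k}"
      using verts by (auto simp: in_lists_conv_set)
  qed
  have "map (\<lambda>(a, r). (map_prod ?f ?f a, r)) (E_powers m i j k p q r s) = E_powers m i' j' k' p q r s"
    using assms by (auto simp: E_powers_def)
  then show "map ?f ` walks_with_arcs (E_powers m i j k p q r s)
      \<subseteq> walks_with_arcs (E_powers m i' j' k' p q r s)"
    using mset_powers_image[of _ "E_powers m i j k p q r s" "map_prod ?f ?f"]
    by (auto simp: walks_with_arcs_def closed_walk_arcs_map)
qed (rule finite_walks_with_arcs)

lemma w_eq: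
  assumes "i \<noteq> j" "i \<noteq> k" "j \<noteq> k"
  shows "w m p q r s = card (walks_with_arcs (E_powers m i j k (int p) (int q) (int r) (int s)))"
  unfolding w_def using assms by (intro antisym card_walks_E_le) auto


subsection \<open>The trace is a number\<close>

lemma lookup_cpoly_deriv:
  "Poly_Mapping.lookup (cpoly_deriv v P) \<mu> =
     of_nat (Suc (Poly_Mapping.lookup \<mu> v)) * Poly_Mapping.lookup P (\<mu> + Poly_Mapping.single v 1)"
proof -
  let ?e = "Poly_Mapping.single v (1::nat)"
  have eq: "(of_nat (Poly_Mapping.lookup \<nu> v) * Poly_Mapping.lookup P \<nu> when \<nu> - ?e = \<mu>)
      = (of_nat (Poly_Mapping.lookup \<nu> v) * Poly_Mapping.lookup P \<nu> when \<nu> = \<mu> + ?e)" for \<nu>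
  proof (cases "Poly_Mapping.lookup \<nu> v = 0")
    case False
    then have "\<nu> - ?e + ?e = \<nu>"
      by (intro poly_mapping_eqI) (auto simp: lookup_add lookup_minus lookup_single when_def)
    then have "\<nu> - ?e = \<mu> \<longleftrightarrow> \<nu> = \<mu> + ?e"
      by (metis add_diff_cancel_right')
    then show ?thesis
      by simp
  qed simp
  have "Poly_Mapping.lookup (cpoly_deriv v P) \<mu>
      = (\<Sum>\<nu>\<in>Poly_Mapping.keys P.
          (of_nat (Poly_Mapping.lookup \<nu> v) * Poly_Mapping.lookup P \<nu> when \<nu> = \<mu> + ?e))"
    unfolding cpoly_deriv_def lookup_sum lookup_single eq ..
  also have "\<dots> = of_nat (Poly_Mapping.lookup (\<mu> + ?e) v) * Poly_Mapping.lookup P (\<mu> + ?e)"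
    by (auto simp: when_def sum.delta in_keys_iff)
  finally show ?thesis
    by (simp add: lookup_add lookup_single)
qed

definition mon_degree :: "('v \<Rightarrow>\<^sub>0 nat) \<Rightarrow> nat" where
  "mon_degree \<mu> = (\<Sum>v\<in>Poly_Mapping.keys \<mu>. Poly_Mapping.lookup \<mu> v)"

definition homogeneous :: "nat \<Rightarrow> 'v cpoly \<Rightarrow> bool" where
  "homogeneous k P \<longleftrightarrow> (\<forall>\<mu>. Poly_Mapping.lookup P \<mu> \<noteq> 0 \<longrightarrow> mon_degree \<mu> = k)"

lemma mon_degree_add: "mon_degree (\<mu> + \<nu>) = mon_degree \<mu> + mon_degree \<nu>"
proof -
  let ?K = "Poly_Mapping.keys \<mu> \<union> Poly_Mapping.keys \<nu>"
  have *: "mon_degree \<kappa> = (\<Sum>v\<in>?K. Poly_Mapping.lookup \<kappa> v)"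
    if "Poly_Mapping.keys \<kappa> \<subseteq> ?K" for \<kappa>
    unfolding mon_degree_def using that
    by (intro sum.mono_neutral_left) (auto simp: in_keys_iff)
  show ?thesis
    using *[of "\<mu> + \<nu>"] *[of \<mu>] *[of \<nu>]
    by (simp add: keys_add lookup_add sum.distrib)
qed

lemma mon_degree_single [simp]: "mon_degree (Poly_Mapping.single v c) = c"
  by (simp add: mon_degree_def)

lemma mon_degree_0 [simp]: "mon_degree 0 = 0"
  by (simp add: mon_degree_def)

lemma mon_degree_eq_0D: "mon_degree \<mu> = 0 \<Longrightarrow> \<mu> = 0"
  by (auto simp: mon_degree_def in_keys_iff intro!: poly_mapping_eqI)

lemma homogeneous_sum:
  assumes "\<And>x. x \<in> A \<Longrightarrow> homogeneous k (f x)"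
  shows "homogeneous k (sum f A)"
  using assms unfolding homogeneous_def lookup_sum by (metis sum.neutral)

lemma homogeneous_mult:
  assumes "homogeneous a P" "homogeneous b Q"
  shows "homogeneous (a + b) (P * Q)"
  unfolding homogeneous_def
proof safe
  fix \<mu> assume "Poly_Mapping.lookup (P * Q) \<mu> \<noteq> 0"
  then have "\<mu> \<in> {x + y |x y. x \<in> Poly_Mapping.keys P \<and> y \<in> Poly_Mapping.keys Q}"
    using keys_mult[of P Q] by (auto simp: in_keys_iff)
  then show "mon_degree \<mu> = a + b"
    using assms by (auto simp: homogeneous_def in_keys_iff mon_degree_add)
qed

lemma homogeneous_const: "homogeneous 0 (cpoly_const c)"
  by (auto simp: homogeneous_def cpoly_const_def lookup_single when_def)

lemma homogeneous_var: "homogeneous 1 (cpoly_var v)"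
  by (auto simp: homogeneous_def cpoly_var_def lookup_single when_def split: if_splits)

lemma homogeneous_deriv:
  assumes "homogeneous k P" shows "homogeneous (k - 1) (cpoly_deriv v P)"
  using assms by (auto simp: homogeneous_def lookup_cpoly_deriv mon_degree_add)

lemma homogeneous_generic_power:
  "\<forall>i<n. \<forall>j<n. homogeneous k ((generic_mat n ^\<^sub>m k) $$ (i, j))"
proof (induction k)
  case 0
  have "homogeneous 0 (1 :: (nat \<times> nat) cpoly)"
    using homogeneous_const[of 1] by (simp add: cpoly_const_def)
  moreover have "homogeneous 0 (0 :: (nat \<times> nat) cpoly)"
    by (simp add: homogeneous_def)
  ultimately show ?case
    by (auto simp: generic_mat_def)
next
  case (Suc k)
  have dim: "generic_mat n ^\<^sub>m k \<in> carrier_mat n n"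
    by (simp add: generic_mat_def)
  show ?case
  proof safe
    fix i j assume ij: "i < n" "j < n"
    then have "(generic_mat n ^\<^sub>m Suc k) $$ (i, j)
        = (\<Sum>l<n. (generic_mat n ^\<^sub>m k) $$ (i, l) * cpoly_var (Suc l, Suc j))"
      using dim by (auto simp: scalar_prod_def generic_mat_def atLeast0LessThan intro!: sum.cong)
    moreover have "homogeneous (k + 1) ((generic_mat n ^\<^sub>m k) $$ (i, l) * cpoly_var (Suc l, Suc j))"
      if "l < n" for l
      using Suc that ij by (intro homogeneous_mult homogeneous_var) auto
    ultimately show "homogeneous (Suc k) ((generic_mat n ^\<^sub>m Suc k) $$ (i, j))"
      by (auto intro!: homogeneous_sum)
  qed
qed

lemma homogeneous_tensor_op:
  assumes "homogeneous k P" shows "homogeneous (k - (m - 1)) (tensor_op n m T i P)"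
proof -
  have "homogeneous (k - length y) (foldr (\<lambda>s. cpoly_deriv (i, s)) y P)" for y
  proof (induction y)
    case (Cons s y)
    then show ?case
      using homogeneous_deriv[of "k - length y"] by fastforce
  qed (use assms in simp)
  then have foldr: "homogeneous (k - length y) (foldr (\<lambda>s. cpoly_deriv (i, s)) y P)" for y .
  have "homogeneous (0 + (k - (m - 1))) (cpoly_const c * foldr (\<lambda>s. cpoly_deriv (i, s)) y P)"
    if "y \<in> tuples n (m - 1)" for c y
  proof -
    have "length y = m - 1"
      using that by (simp add: tuples_def)
    then show ?thesis
      using homogeneous_mult[OF homogeneous_const foldr[of y]] by (metis (no_types))
  qed
  then show ?thesis
    unfolding tensor_op_def by (intro homogeneous_sum) simp
qed

lemma Tr_summand_const:
  assumes "(\<Sum>i=1..n. \<delta> i) = d"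
  shows "Tr_summand n m T d \<delta> = cpoly_const (Poly_Mapping.lookup (Tr_summand n m T d \<delta>) 0)"
proof -
  let ?step = "\<lambda>i P. cpoly_const (1 / fact (\<delta> i * (m - 1))) * (tensor_op n m T i ^^ \<delta> i) P"
  have pow: "homogeneous (k - e * (m - 1)) ((tensor_op n m T i ^^ e) P)" if "homogeneous k P" for k e i P
  proof (induction e)
    case (Suc e)
    then show ?case
      using homogeneous_tensor_op[OF Suc, of m n T i] by (simp add: add.commute)
  qed (use that in simp)
  have "homogeneous (k - (\<Sum>i\<leftarrow>is. \<delta> i) * (m - 1)) (foldr ?step is P)"
    if "homogeneous k P" for k P "is"
  proof (induction "is")
    case (Cons i "is")
    from homogeneous_mult[OF homogeneous_const pow[OF Cons]] show ?case
      by (simp add: add_mult_distrib add.commute)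
  qed (use that in simp)
  moreover have "homogeneous (d * (m - 1)) (generic_power_trace n (d * (m - 1)))"
    unfolding generic_power_trace_def
    by (intro homogeneous_sum) (use homogeneous_generic_power in auto)
  ultimately have "homogeneous (d * (m - 1) - (\<Sum>i\<leftarrow>[1..<Suc n]. \<delta> i) * (m - 1)) (Tr_summand n m T d \<delta>)"
    unfolding Tr_summand_def by blast
  moreover have "(\<Sum>i\<leftarrow>[1..<Suc n]. \<delta> i) = d"
    using assms by (metis atLeastLessThanSuc_atLeastAtMost interv_sum_list_conv_sum_set_nat set_upt)
  ultimately have "homogeneous 0 (Tr_summand n m T d \<delta>)"
    by simp
  then show ?thesis
    unfolding homogeneous_def cpoly_const_def
    by (intro poly_mapping_eqI) (auto simp: lookup_single when_def dest: mon_degree_eq_0D)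
qed

lemma finite_compositions:
  "finite {\<delta> :: nat \<Rightarrow> nat. \<delta> \<in> {1..n} \<rightarrow>\<^sub>E UNIV \<and> (\<Sum>i=1..n. \<delta> i) = d}"
proof (rule finite_subset)
  show "{\<delta>. \<delta> \<in> {1..n} \<rightarrow>\<^sub>E UNIV \<and> (\<Sum>i=1..n. \<delta> i) = d} \<subseteq> {1..n} \<rightarrow>\<^sub>E {..d}"
    by (auto simp: PiE_iff extensional_def intro!: member_le_sum)
qed (intro finite_PiE; simp)

end

theory Submission
  imports Defs
begin

text \<open>
  The coefficient of the monomial \<open>a\<^sup>E\<close> in \<open>tr (A\<^sup>k)\<close> is the number of closed walks with arc
  multi-set \<open>E\<close>, and applying \<open>\<partial>\<^sup>E\<close> to a form of degree \<open>|E|\<close> extracts that coefficient times the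
  factorials of the multiplicities of \<open>E\<close>. Hence the trace is a sum, over the multi-sets
  \<open>{i\<^sub>1, i\<^sub>2, i\<^sub>3}\<close> of vertices, of products of three tensor entries weighted by walk counts. The arc
  multi-set of a closed walk is balanced (equal in- and out-degrees). For \<open>i i i\<close> this leaves only
  loops; for \<open>i i j\<close> it leaves a single parameter \<open>s\<close>, the number of arcs in either direction, and
  the walks are counted by distributing loops among the \<open>s\<close> stays at each vertex; for three
  distinct vertices it leaves exactly the four parameters \<open>p, q, r, s\<close>.
\<close>


section \<open>Iterated derivatives and the operators of the trace\<close>

text \<open>Composites of commuting maps depend only on the multi-set of indices. This serves both
  the partial derivatives and the operators \<open>tensor_op\<close>.\<close>

lemma foldr_mset_eq:
  assumes "\<And>x y. f x \<circ> f y = f y \<circ> f x" "mset xs = mset ys"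
  shows "foldr f xs = foldr f ys"
  unfolding foldr_conv_fold using assms by (intro fold_multiset_equiv) auto

lemma lookup_cpoly_const_mult:
  "Poly_Mapping.lookup (cpoly_const c * P) \<mu> = c * Poly_Mapping.lookup P \<mu>"
  unfolding cpoly_const_def mult_map_scale_conv_mult[symmetric]
  by (simp add: Poly_Mapping.map.rep_eq when_def)

lemma cpoly_deriv_commute:
  "cpoly_deriv u \<circ> cpoly_deriv v = cpoly_deriv v \<circ> cpoly_deriv u"
proof (intro ext poly_mapping_eqI)
  fix P :: "'a cpoly" and \<mu>
  show "Poly_Mapping.lookup ((cpoly_deriv u \<circ> cpoly_deriv v) P) \<mu>
      = Poly_Mapping.lookup ((cpoly_deriv v \<circ> cpoly_deriv u) P) \<mu>"
    by (cases "u = v") (simp_all add: lookup_cpoly_deriv lookup_add lookup_single add_ac)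
qed

lemma cpoly_deriv_sum: "cpoly_deriv v (sum f A) = (\<Sum>x\<in>A. cpoly_deriv v (f x))"
  by (intro poly_mapping_eqI) (simp add: lookup_cpoly_deriv lookup_sum sum_distrib_left)

lemma cpoly_deriv_const_mult:
  "cpoly_deriv v (cpoly_const c * P) = cpoly_const c * cpoly_deriv v P"
  by (intro poly_mapping_eqI) (simp add: lookup_cpoly_deriv lookup_cpoly_const_mult)

lemma foldr_cpoly_deriv_sum:
  "foldr cpoly_deriv L (sum f A) = (\<Sum>x\<in>A. foldr cpoly_deriv L (f x))"
  by (induction L) (simp_all add: cpoly_deriv_sum)

lemma foldr_cpoly_deriv_const_mult:
  "foldr cpoly_deriv L (cpoly_const c * P) = cpoly_const c * foldr cpoly_deriv L P"
  by (induction L) (simp_all add: cpoly_deriv_const_mult)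

text \<open>The list \<open>L\<close> carries the derivatives collected so far. Each operator
  appends the variables of one tuple, so nested operators unfold one after another into sums over
  tuples.\<close>

lemma lookup_foldr_deriv_tensor_op:
  "Poly_Mapping.lookup (foldr cpoly_deriv L (tensor_op n m T i P)) \<mu> =
     (\<Sum>y\<in>tuples n (m - 1). T (i # y) *
        Poly_Mapping.lookup (foldr cpoly_deriv (L @ map (Pair i) y) P) \<mu>)"
  by (simp add: tensor_op_def foldr_cpoly_deriv_sum foldr_cpoly_deriv_const_mult lookup_sum
      lookup_cpoly_const_mult foldr_map comp_def)

lemma tensor_op_const_mult:
  "tensor_op n m T i (cpoly_const c * P) = cpoly_const c * tensor_op n m T i P"
proof (intro poly_mapping_eqI)
  fix \<mu>
  show "Poly_Mapping.lookup (tensor_op n m T i (cpoly_const c * P)) \<mu>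
      = Poly_Mapping.lookup (cpoly_const c * tensor_op n m T i P) \<mu>"
    \<comment> \<open>With the empty list the formula gives the coefficients of
      \<open>tensor_op\<close> itself.\<close>
    using lookup_foldr_deriv_tensor_op[of "[]"]
    by (simp add: lookup_cpoly_const_mult foldr_cpoly_deriv_const_mult sum_distrib_left mult.left_commute)
qed

lemma tensor_op_commute:
  "tensor_op n m T i \<circ> tensor_op n m T j = tensor_op n m T j \<circ> tensor_op n m T i"
proof (intro ext poly_mapping_eqI)
  fix P :: "(nat \<times> nat) cpoly" and \<mu>
  let ?D = "\<lambda>L. Poly_Mapping.lookup (foldr cpoly_deriv L P) \<mu>"
  have *: "Poly_Mapping.lookup ((tensor_op n m T i \<circ> tensor_op n m T j) P) \<mu>
      = (\<Sum>y\<in>tuples n (m - 1). \<Sum>z\<in>tuples n (m - 1).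
           T (i # y) * T (j # z) * ?D (map (Pair i) y @ map (Pair j) z))" for i j
    using lookup_foldr_deriv_tensor_op[of "[]"]
    by (simp add: lookup_foldr_deriv_tensor_op sum_distrib_left mult.assoc)
  \<comment> \<open>Exchanging the two operators only permutes the list of derivatives, and these
    commute.\<close>
  have "?D (map (Pair i) y @ map (Pair j) z) = ?D (map (Pair j) z @ map (Pair i) y)" for y z
    by (subst foldr_mset_eq[OF cpoly_deriv_commute, where ys = "map (Pair j) z @ map (Pair i) y"]) simp_all
  then show "Poly_Mapping.lookup ((tensor_op n m T i \<circ> tensor_op n m T j) P) \<mu>
      = Poly_Mapping.lookup ((tensor_op n m T j \<circ> tensor_op n m T i) P) \<mu>"
    unfolding * by (subst sum.swap) (simp add: mult_ac)
qed

lemma lookup_tensor_op3: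
  "Poly_Mapping.lookup (foldr (tensor_op n m T) [i, j, k] P) 0 =
     (\<Sum>x\<in>tuples n (m - 1). \<Sum>y\<in>tuples n (m - 1). \<Sum>z\<in>tuples n (m - 1).
        T (i # x) * T (j # y) * T (k # z) *
        Poly_Mapping.lookup
          (foldr cpoly_deriv (map (Pair i) x @ map (Pair j) y @ map (Pair k) z) P) 0)"
  using lookup_foldr_deriv_tensor_op[of "[]"]
  by (simp add: lookup_foldr_deriv_tensor_op sum_distrib_left mult.assoc flip: foldr_append)

text \<open>By linearity all scalars move to the front. What remains is one fold over a list that
  contains each vertex \<open>i\<close> exactly \<open>\<delta> i\<close> times, so that only its
  multi-set matters.\<close>

lemma Tr_summand_eq_foldr:
  "Tr_summand n m T d \<delta> =
     cpoly_const (\<Prod>i=1..n. 1 / fact (\<delta> i * (m - 1))) *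
     foldr (tensor_op n m T) (concat (map (\<lambda>i. replicate (\<delta> i) i) [1..<Suc n]))
       (generic_power_trace n (d * (m - 1)))"
proof -
  have pow: "(tensor_op n m T i ^^ e) (cpoly_const c * P) = cpoly_const c * (tensor_op n m T i ^^ e) P"
    for i e c P
    by (induction e) (simp_all add: tensor_op_const_mult)
  have const_mult: "cpoly_const a * (cpoly_const b * P) = cpoly_const (a * b) * P"
    for a b and P :: "(nat \<times> nat) cpoly"
    by (intro poly_mapping_eqI) (simp add: lookup_cpoly_const_mult)
  have rep: "foldr f (replicate e i) P = (f i ^^ e) P" for f :: "nat \<Rightarrow> (nat \<times> nat) cpoly \<Rightarrow> _" and e i P
    by (induction e) simp_all
  have one: "cpoly_const 1 * P = P" for P :: "(nat \<times> nat) cpoly"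
    by (intro poly_mapping_eqI) (simp add: lookup_cpoly_const_mult)
  have "foldr (\<lambda>i P. cpoly_const (1 / fact (\<delta> i * (m - 1))) * (tensor_op n m T i ^^ \<delta> i) P) L P
      = cpoly_const (\<Prod>i\<leftarrow>L. 1 / fact (\<delta> i * (m - 1))) *
        foldr (tensor_op n m T) (concat (map (\<lambda>i. replicate (\<delta> i) i) L)) P" for L P
    by (induction L) (simp_all add: pow const_mult rep one)
  then show ?thesis
    unfolding Tr_summand_def
    by (simp add: prod.distinct_set_conv_list[symmetric] atLeastLessThanSuc_atLeastAtMost
        del: upt_Suc)
qed


section \<open>Coefficients of the generic power trace\<close>

definition monomial :: "'v multiset \<Rightarrow> 'v \<Rightarrow>\<^sub>0 nat" where
  "monomial E = (\<Sum>v\<in>#E. Poly_Mapping.single v 1)"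

lemma monomial_simps [simp]:
  "monomial {#} = 0"
  "monomial (add_mset v E) = Poly_Mapping.single v 1 + monomial E"
  by (simp_all add: monomial_def)

lemma lookup_monomial: "Poly_Mapping.lookup (monomial E) v = count E v"
  by (induction E) (auto simp: lookup_add lookup_single when_def)

lemma monomial_inject: "monomial E = monomial F \<longleftrightarrow> E = F"
  by (metis lookup_monomial multiset_eqI)

text \<open>A derivative by \<open>v\<close> raises by one the exponent at which the coefficient is
  read and contributes the raised exponent as a factor. Starting from exponent 0, these factors
  build up the factorials.\<close>

lemma lookup_foldr_cpoly_deriv:
  "Poly_Mapping.lookup (foldr cpoly_deriv L P) 0 =
     (\<Prod>v\<in>set L. fact (count (mset L) v)) * Poly_Mapping.lookup P (monomial (mset L))"
proof -
  \<comment> \<open>Generalised to any exponent vector, since removing the head of \<open>L\<close>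
    shifts it. The factorials of \<open>\<mu>\<close> stand on the left to avoid division, and
    \<open>V\<close> stays fixed while \<open>L\<close> shrinks.\<close>
  have "Poly_Mapping.lookup (foldr cpoly_deriv L P) \<mu> * (\<Prod>v\<in>V. fact (Poly_Mapping.lookup \<mu> v)) =
     (\<Prod>v\<in>V. fact (Poly_Mapping.lookup (\<mu> + monomial (mset L)) v)) *
     Poly_Mapping.lookup P (\<mu> + monomial (mset L))"
    if "finite V" "set L \<subseteq> V" for V \<mu>
    using that(2)
  proof (induction L arbitrary: \<mu>)
    case (Cons v L)
    let ?e = "Poly_Mapping.single v (1::nat)"
    have v: "v \<in> V"
      using Cons.prems by simp
    have "(\<Prod>u\<in>V - {v}. fact (Poly_Mapping.lookup (\<mu> + ?e) u))
        = (\<Prod>u\<in>V - {v}. fact (Poly_Mapping.lookup \<mu> u) :: complex)"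
      by (intro prod.cong) (auto simp: lookup_add lookup_single)
    then have "(\<Prod>u\<in>V. fact (Poly_Mapping.lookup (\<mu> + ?e) u))
        = of_nat (Suc (Poly_Mapping.lookup \<mu> v)) * (\<Prod>u\<in>V. fact (Poly_Mapping.lookup \<mu> u) :: complex)"
      unfolding prod.remove[OF that(1) v] by (simp add: lookup_add algebra_simps)
    then show ?case
      using Cons.IH[of "\<mu> + ?e"] Cons.prems by (simp add: lookup_cpoly_deriv mult_ac add_ac)
  qed simp
  from this[of "set L" 0] show ?thesis
    by (simp add: lookup_monomial)
qed

text \<open>The list \<open>vs\<close> stores all vertices of a walk except its end
  \<open>Suc v\<close>. Hence a walk of \<open>k\<close> arcs is a list of length \<open>k\<close>,
  and \<open>hd (vs @ [Suc v])\<close> is its start even when \<open>k = 0\<close>. The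
  \<open>Suc\<close> passes from matrix positions to vertices.\<close>

lemma generic_mat_power_entry:
  assumes "u < n" "v < n"
  shows "(generic_mat n ^\<^sub>m k) $$ (u, v) =
    (\<Sum>vs | vs \<in> tuples n k \<and> hd (vs @ [Suc v]) = Suc u.
       Poly_Mapping.single (monomial (mset (zip vs (tl (vs @ [Suc v]))))) 1)"
  using assms(2)
proof (induction k arbitrary: v)
  case 0
  have "{vs. vs \<in> tuples n 0 \<and> hd (vs @ [Suc v]) = Suc u} = (if u = v then {[]} else {})"
    by (auto simp: tuples_def)
  then show ?case
    using assms(1) 0 by (auto simp: generic_mat_def)
next
  case (Suc k)
  let ?m = "\<lambda>vs v. Poly_Mapping.single (monomial (mset (zip vs (tl (vs @ [v]))))) (1::complex)"
  have dim: "generic_mat n ^\<^sub>m k \<in> carrier_mat n n"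
    by (simp add: generic_mat_def)
  \<comment> \<open>Multiplying by the variable of a new last arc turns the old end
    \<open>Suc l\<close> into a stored vertex.\<close>
  have step: "?m vs (Suc l) * cpoly_var (Suc l, Suc v) = ?m (vs @ [Suc l]) (Suc v)" for vs l
  proof -
    have "tl ((vs @ [Suc l]) @ [Suc v]) = tl (vs @ [Suc l]) @ [Suc v]"
      by (cases vs) simp_all
    then have "zip (vs @ [Suc l]) (tl ((vs @ [Suc l]) @ [Suc v]))
        = zip vs (tl (vs @ [Suc l])) @ [(Suc l, Suc v)]"
      by (simp only:) (subst zip_append; simp)
    then show ?thesis
      by (simp add: cpoly_var_def mult_single add.commute)
  qed
  have "(generic_mat n ^\<^sub>m Suc k) $$ (u, v)
      = (\<Sum>l<n. (generic_mat n ^\<^sub>m k) $$ (u, l) * cpoly_var (Suc l, Suc v))"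
    using dim assms(1) Suc.prems
    by (auto simp: scalar_prod_def generic_mat_def atLeast0LessThan intro!: sum.cong)
  also have "\<dots> = (\<Sum>l<n. \<Sum>vs | vs \<in> tuples n k \<and> hd (vs @ [Suc l]) = Suc u. ?m (vs @ [Suc l]) (Suc v))"
    by (intro sum.cong refl) (simp add: Suc.IH sum_distrib_right step del: append_assoc)
  also have "\<dots> = (\<Sum>(l, vs)\<in>(SIGMA l:{..<n}. {vs \<in> tuples n k. hd (vs @ [Suc l]) = Suc u}).
                     ?m (vs @ [Suc l]) (Suc v))"
    by (intro sum.Sigma) auto
  also have "\<dots> = (\<Sum>vs | vs \<in> tuples n (Suc k) \<and> hd (vs @ [Suc v]) = Suc u. ?m vs (Suc v))"
  \<comment> \<open>The vertex before the end is the last stored one; it equals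
    \<open>Suc l\<close>, hence the \<open>- 1\<close>.\<close>
  proof (intro sum.reindex_bij_witness[where i = "\<lambda>vs. (last vs - 1, butlast vs)"
        and j = "\<lambda>(l, vs). vs @ [Suc l]"], goal_cases)
    case (4 vs)
    then have "vs \<noteq> []" "set vs \<subseteq> {1..n}" "length vs = Suc k"
      by (auto simp: tuples_def)
    then have "last vs \<in> {1..n}" "set (butlast vs) \<subseteq> {1..n}"
      using in_set_butlastD by fastforce+
    moreover have "hd (butlast vs @ [last vs]) = Suc u"
      using 4 \<open>vs \<noteq> []\<close> by simp
    ultimately show ?case
      using \<open>length vs = Suc k\<close> by (auto simp: tuples_def)
  next
    case (3 vs)
    then have "vs \<noteq> []" "set vs \<subseteq> {1..n}"
      by (auto simp: tuples_def)
    then have "last vs \<in> {1..n}"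
      by (meson last_in_set subsetD)
    then show ?case
      using \<open>vs \<noteq> []\<close> by simp
  next
    case (2 x)
    then show ?case
      by (cases "snd x") (auto simp: tuples_def)
  qed (auto simp: tuples_def)
  finally show ?case .
qed

text \<open>The diagonal entries sort the closed walks by initial vertex. For \<open>k = 0\<close>
  the trace would be \<open>n\<close>, although there is only one empty walk.\<close>

lemma lookup_generic_power_trace:
  assumes "k > 0"
  shows "Poly_Mapping.lookup (generic_power_trace n k) (monomial E)
       = of_nat (card {vs \<in> tuples n k. closed_walk_arcs vs = E})"
proof -
  have "generic_power_trace n k = (\<Sum>v<n. \<Sum>vs | vs \<in> tuples n k \<and> hd vs = Suc v.
      Poly_Mapping.single (monomial (closed_walk_arcs vs)) 1)"
    unfolding generic_power_trace_def
  proof (intro sum.cong refl)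
    fix v assume "v \<in> {..<n}"
    moreover have "hd (vs @ [u]) = hd vs" "tl (vs @ [hd vs]) = rotate1 vs"
      if "vs \<in> tuples n k" for vs u
      using that assms by (cases vs; auto simp: tuples_def)+
    then have "vs \<in> tuples n k \<Longrightarrow> hd vs = Suc v \<Longrightarrow> tl (vs @ [Suc v]) = rotate1 vs"
      "vs \<in> tuples n k \<Longrightarrow> hd (vs @ [Suc v]) = hd vs" for vs
      by metis+
    ultimately show "(generic_mat n ^\<^sub>m k) $$ (v, v) = (\<Sum>vs | vs \<in> tuples n k \<and> hd vs = Suc v.
      Poly_Mapping.single (monomial (closed_walk_arcs vs)) 1)"
      by (subst generic_mat_power_entry) (auto simp: closed_walk_arcs_def intro!: sum.cong)
  qed
  also have "\<dots> = (\<Sum>(v, vs)\<in>(SIGMA v:{..<n}. {vs \<in> tuples n k. hd vs = Suc v}).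
      Poly_Mapping.single (monomial (closed_walk_arcs vs)) 1)"
    by (intro sum.Sigma) auto
  also have "\<dots> = (\<Sum>vs\<in>tuples n k. Poly_Mapping.single (monomial (closed_walk_arcs vs)) 1)"
  proof (intro sum.reindex_bij_witness[where i = "\<lambda>vs. (hd vs - 1, vs)" and j = snd], goal_cases)
    case (4 vs)
    then have "hd vs \<in> {1..n}"
      using assms by (cases vs) (auto simp: tuples_def)
    then show ?case
      using 4 by auto
  qed auto
  finally show ?thesis
    by (auto simp: lookup_sum lookup_single when_def monomial_inject sum.If_cases Int_def)
qed

lemma tuples_length: "y \<in> tuples n l \<Longrightarrow> length y = l"
  by (simp add: tuples_def)

text \<open>Since \<open>rotate1\<close> permutes the vertices, each vertex is as often the head as
  the tail of an arc. All later restrictions on the contributing multi-sets come from this.\<close>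

lemma closed_walk_arcs_balanced:
  "image_mset snd (closed_walk_arcs vs) = image_mset fst (closed_walk_arcs vs)"
proof -
  have "mset (rotate1 vs) = mset vs"
    by (cases vs) simp_all
  then show ?thesis
    by (simp add: closed_walk_arcs_def flip: mset_map)
qed


section \<open>Third-order traces as sums over multi-sets of three vertices\<close>

definition mset_fact :: "'a multiset \<Rightarrow> complex" where
  "mset_fact E = (\<Prod>v\<in>set_mset E. fact (count E v))"

lemma mset_fact_add:
  assumes "set_mset A \<inter> set_mset B = {}"
  shows "mset_fact (A + B) = mset_fact A * mset_fact B"
proof -
  have "mset_fact (A + B) = (\<Prod>v\<in>set_mset A. fact (count (A + B) v)) * (\<Prod>v\<in>set_mset B. fact (count (A + B) v))"
    unfolding mset_fact_def set_mset_union using assms by (intro prod.union_disjoint) auto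
  moreover have "(\<Prod>v\<in>set_mset A. fact (count (A + B) v)) = mset_fact A"
    "(\<Prod>v\<in>set_mset B. fact (count (A + B) v)) = mset_fact B"
    unfolding mset_fact_def using assms
    by (auto intro!: prod.cong simp: disjoint_iff not_in_iff) (metis add_0 not_in_iff)
  ultimately show ?thesis
    by simp
qed

lemma mset_fact_replicate: "mset_fact (replicate_mset k a) = fact k"
  by (cases k) (simp_all add: mset_fact_def)

lemma mset_fact_image_Pair: "mset_fact (image_mset (Pair i) A) = mset_fact A"
proof -
  have "count (image_mset (Pair i) A) (i, v) = count A v" for v
    by (induction A) auto
  then show ?thesis
    by (simp add: mset_fact_def prod.reindex inj_on_def)
qed

text \<open>For a nonempty \<open>E\<close> on the vertices \<open>1..n\<close> this is the result
  of differentiating the trace of the power \<open>size E\<close> of the generic matrix by all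
  variables in \<open>E\<close>. The vertices of the walks are unrestricted, as the arcs determine
  them.\<close>

definition walk_weight :: "('a \<times> 'a) multiset \<Rightarrow> complex" where
  "walk_weight E = mset_fact E * of_nat (card {vs. closed_walk_arcs vs = E})"

lemma walk_weight_nonzero_balanced:
  assumes "walk_weight E \<noteq> 0"
  shows "image_mset snd E = image_mset fst E"
proof -
  have "card {vs. closed_walk_arcs vs = E} \<noteq> 0"
    using assms by (auto simp: walk_weight_def simp del: card_0_eq)
  then have "{vs. closed_walk_arcs vs = E} \<noteq> {}"
    by force
  then show ?thesis
    using closed_walk_arcs_balanced by blast
qed

text \<open>The variables of the derivative attached to one tensor entry, read as arcs with common
  tail \<open>i\<close>.\<close>

definition arcs_from :: "'a \<Rightarrow> 'a list \<Rightarrow> ('a \<times> 'a) multiset" where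
  "arcs_from i y = image_mset (Pair i) (mset y)"

lemma arcs_from_simps [simp]:
  "size (arcs_from i y) = length y"
  "image_mset fst (arcs_from i y) = replicate_mset (length y) i"
  "image_mset snd (arcs_from i y) = mset y"
  by (simp_all add: arcs_from_def multiset.map_comp comp_def image_mset_const_eq)

lemma mset_fact_arcs_from [simp]: "mset_fact (arcs_from i y) = mset_fact (mset y)"
  by (simp add: arcs_from_def mset_fact_image_Pair)

text \<open>The three operators at \<open>i\<close>, \<open>j\<close>, \<open>k\<close> applied to
  the trace of the generic power \<open>3 * (m - 1)\<close>, without the normalising
  factorials.\<close>

definition trace3 :: "nat \<Rightarrow> nat \<Rightarrow> (nat list \<Rightarrow> complex) \<Rightarrow> nat \<Rightarrow> nat \<Rightarrow> nat \<Rightarrow> complex" where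
  "trace3 n m T i j k =
     (\<Sum>x\<in>tuples n (m - 1). \<Sum>y\<in>tuples n (m - 1). \<Sum>z\<in>tuples n (m - 1).
        T (i # x) * T (j # y) * T (k # z) *
        walk_weight (arcs_from i x + arcs_from j y + arcs_from k z))"

text \<open>The product runs over the set \<open>{i, j, k}\<close>, so a repeated vertex contributes
  a single factorial with its full multiplicity. This covers all patterns of coincidence at
  once.\<close>

lemma lookup_Tr_summand3:
  assumes "m \<ge> 2" and ijk: "i \<in> {1..n}" "j \<in> {1..n}" "k \<in> {1..n}"
  shows "Poly_Mapping.lookup (Tr_summand n m T 3 (restrict (count {#i, j, k#}) {1..n})) 0
       = (\<Prod>v\<in>{i, j, k}. 1 / fact (count {#i, j, k#} v * (m - 1))) * trace3 n m T i j k"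
proof -
  let ?\<delta> = "restrict (count {#i, j, k#}) {1..n}"
  have "mset (concat (map (\<lambda>i. replicate (?\<delta> i) i) [1..<Suc n])) = {#i, j, k#}"
  proof (rule multiset_eqI)
    fix v
    have "mset (concat (map (\<lambda>i. replicate (?\<delta> i) i) L)) = (\<Sum>i\<leftarrow>L. replicate_mset (?\<delta> i) i)" for L
      by (induction L) simp_all
    then have "count (mset (concat (map (\<lambda>i. replicate (?\<delta> i) i) [1..<Suc n]))) v
        = (\<Sum>i=1..n. if i = v then ?\<delta> i else 0)"
      by (simp add: sum.distinct_set_conv_list[symmetric] count_sum atLeastLessThanSuc_atLeastAtMost
          del: upt_Suc)
    also have "\<dots> = count {#i, j, k#} v"
      using ijk by auto
    finally show "count (mset (concat (map (\<lambda>i. replicate (?\<delta> i) i) [1..<Suc n]))) v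
        = count {#i, j, k#} v" .
  qed
  then have mset: "mset (concat (map (\<lambda>i. replicate (?\<delta> i) i) [1..<Suc n])) = mset [i, j, k]"
    by simp
  have coeff: "Poly_Mapping.lookup
      (foldr cpoly_deriv (map (Pair i) x @ map (Pair j) y @ map (Pair k) z)
        (generic_power_trace n (3 * (m - 1)))) 0
      = walk_weight (arcs_from i x + arcs_from j y + arcs_from k z)" (is "?l = walk_weight ?E")
    if "x \<in> tuples n (m - 1)" "y \<in> tuples n (m - 1)" "z \<in> tuples n (m - 1)" for x y z
  proof -
    let ?L = "map (Pair i) x @ map (Pair j) y @ map (Pair k) z"
    have E: "mset ?L = ?E"
      by (simp add: arcs_from_def add.assoc)
    \<comment> \<open>The size and the tails of \<open>?E\<close> fix the length and the vertices of
      a walk, so counting all lists agrees with counting those in \<open>tuples\<close>.\<close>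
    have "vs \<in> tuples n (3 * (m - 1))" if vs: "closed_walk_arcs vs = ?E" for vs
    proof -
      have "length vs = 3 * (m - 1)"
        using size_closed_walk_arcs[of vs] \<open>x \<in> _\<close> \<open>y \<in> _\<close> \<open>z \<in> _\<close> by (simp add: vs tuples_length)
      moreover have "set vs \<subseteq> {i, j, k}"
        unfolding set_mset_mset[symmetric] image_fst_closed_walk_arcs[symmetric] vs by auto
      ultimately show ?thesis
        using ijk by (auto simp: tuples_def)
    qed
    then have "{vs \<in> tuples n (3 * (m - 1)). closed_walk_arcs vs = ?E} = {vs. closed_walk_arcs vs = ?E}"
      by blast
    moreover have "?l = mset_fact ?E * Poly_Mapping.lookup (generic_power_trace n (3 * (m - 1))) (monomial ?E)"
      using lookup_foldr_cpoly_deriv[of ?L] unfolding E set_mset_mset[symmetric] mset_fact_def .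
    ultimately show ?thesis
      using assms(1) by (simp add: lookup_generic_power_trace walk_weight_def)
  qed
  \<comment> \<open>Vertices outside \<open>{i, j, k}\<close> contribute
    \<open>1 / fact 0 = 1\<close>.\<close>
  have "(\<Prod>v=1..n. 1 / fact (?\<delta> v * (m - 1)) :: complex) = (\<Prod>v\<in>{i, j, k}. 1 / fact (?\<delta> v * (m - 1)))"
    using ijk by (intro prod.mono_neutral_right) auto
  also have "\<dots> = (\<Prod>v\<in>{i, j, k}. 1 / fact (count {#i, j, k#} v * (m - 1)))"
    using ijk by (intro prod.cong) auto
  finally have scalars: "(\<Prod>v=1..n. 1 / fact (?\<delta> v * (m - 1)) :: complex)
      = (\<Prod>v\<in>{i, j, k}. 1 / fact (count {#i, j, k#} v * (m - 1)))" .
  show ?thesis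
    unfolding Tr_summand_eq_foldr lookup_cpoly_const_mult scalars
      foldr_mset_eq[OF tensor_op_commute mset] lookup_tensor_op3 trace3_def
    by (intro arg_cong2[where f = "(*)"] sum.cong refl coeff)
qed

section \<open>Compositions of 3 as multi-sets of three vertices\<close>

text \<open>A composition is the multiplicity function of a multi-set; \<open>restrict\<close>
  supplies the values outside \<open>A\<close> that extensional functions must have.\<close>

lemma sum_compositions_eq_sum_multisets:
  assumes "finite A"
  shows "(\<Sum>\<delta> | \<delta> \<in> A \<rightarrow>\<^sub>E UNIV \<and> sum \<delta> A = d. f \<delta>)
     = (\<Sum>N | set_mset N \<subseteq> A \<and> size N = d. f (restrict (count N) A))"
proof (rule sum.reindex_bij_witness[where i = "\<lambda>N. restrict (count N) A"
      and j = "\<lambda>\<delta>. \<Sum>i\<in>A. replicate_mset (\<delta> i) i"], goal_cases)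
  case (1 \<delta>)
  then show ?case
    using assms by (auto simp: count_sum restrict_def PiE_iff extensional_def fun_eq_iff)
next
  case (2 \<delta>)
  have "set_mset (\<Sum>i\<in>A. replicate_mset (\<delta> i) i) \<subseteq> A"
    using assms by (induction A rule: finite_induct) (auto split: if_splits)
  moreover have "size (\<Sum>i\<in>A. replicate_mset (\<delta> i) i) = sum \<delta> A"
    using assms by (induction A rule: finite_induct) auto
  ultimately show ?case
    using 2 by simp
next
  case (3 N)
  then show ?case
    using assms by (intro multiset_eqI) (auto simp: count_sum not_in_iff[symmetric])
next
  case (4 N)
  then have "size N = sum (count N) A"
    unfolding size_multiset_overloaded_eq using assms
    by (intro sum.mono_neutral_left) (auto simp: not_in_iff)
  then show ?case
    using 4 by auto
next
  case (5 \<delta>)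
  then have "restrict (count (\<Sum>i\<in>A. replicate_mset (\<delta> i) i)) A = \<delta>"
    using assms by (auto simp: count_sum restrict_def PiE_iff extensional_def fun_eq_iff)
  then show ?case
    by simp
qed

text \<open>The three sums are the patterns of coincidence. Pairs are ordered because
  \<open>i\<close> is the repeated element, whereas triples are taken increasing.\<close>

lemma sum_multisets_size3:
  fixes f :: "'a :: linorder multiset \<Rightarrow> 'b :: comm_monoid_add"
  assumes "finite A"
  shows "(\<Sum>N | set_mset N \<subseteq> A \<and> size N = 3. f N) =
    (\<Sum>i\<in>A. f {#i, i, i#}) +
    (\<Sum>(i, j) | i \<in> A \<and> j \<in> A \<and> i \<noteq> j. f {#i, i, j#}) +
    (\<Sum>(i, j, k) | i \<in> A \<and> j \<in> A \<and> k \<in> A \<and> i < j \<and> j < k. f {#i, j, k#})"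
proof -
  let ?P = "{(i, j). i \<in> A \<and> j \<in> A \<and> i \<noteq> j}"
  let ?Q = "{(i, j, k). i \<in> A \<and> j \<in> A \<and> k \<in> A \<and> i < j \<and> j < k}"
  let ?f1 = "\<lambda>i. {#i, i, i#}"
  let ?f2 = "\<lambda>(i, j). {#i, i, j#}"
  let ?f3 = "\<lambda>(i, j, k). {#i, j, k#}"
  have fin: "finite ?P" "finite ?Q"
    by (rule finite_subset[of _ "A \<times> A"] finite_subset[of _ "A \<times> A \<times> A"]; use assms in auto)+
  have cover: "{N. set_mset N \<subseteq> A \<and> size N = 3} = ?f1 ` A \<union> (?f2 ` ?P \<union> ?f3 ` ?Q)"
  proof (intro equalityI subsetI)
    fix N assume N: "N \<in> {N. set_mset N \<subseteq> A \<and> size N = 3}"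
    then have "length (sorted_list_of_multiset N) = 3"
      by (metis (mono_tags, lifting) mem_Collect_eq mset_sorted_list_of_multiset size_mset)
    then obtain i j k where L: "sorted_list_of_multiset N = [i, j, k]"
      by (auto simp: numeral_3_eq_3 length_Suc_conv)
    then have NL: "N = {#i, j, k#}"
      by (metis mset_sorted_list_of_multiset mset.simps)
    moreover have "i \<le> j" "j \<le> k"
      using sorted_sorted_list_of_multiset[of N] by (simp_all add: L)
    ultimately consider "i = j \<and> j = k" | "i = j \<and> j < k" | "i < j \<and> j = k" | "i < j \<and> j < k"
      by force
    then show "N \<in> ?f1 ` A \<union> (?f2 ` ?P \<union> ?f3 ` ?Q)"
    proof cases
      \<comment> \<open>Here the larger of the two elements is the repeated one, so the pair is
        reversed.\<close>
      case 3
      then have "N = ?f2 (j, i)" "(j, i) \<in> ?P"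
        using N by (auto simp: NL)
      then show ?thesis by blast
    next
      case 2
      then have "N = ?f2 (i, k)" "(i, k) \<in> ?P"
        using N by (auto simp: NL)
      then show ?thesis by blast
    next
      case 4
      then have "N = ?f3 (i, j, k)" "(i, j, k) \<in> ?Q"
        using N by (auto simp: NL)
      then show ?thesis by blast
    qed (use N in \<open>auto simp: NL\<close>)
  qed auto
  \<comment> \<open>Sorting recovers an increasing triple from its multi-set, which gives
    injectivity of \<open>?f3\<close>.\<close>
  have sorted: "sorted_list_of_multiset {#i, j, k#} = [i, j, k]" if "i < j" "j < k" for i j k :: 'a
    using that order.strict_trans[OF that] by (simp add: less_imp_le)
  have "inj_on ?f1 A"
    by (rule inj_onI) (metis (no_types, lifting) insert_iff set_mset_add_mset_insert singleton_iff set_mset_empty)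
  moreover have "inj_on ?f2 ?P"
  proof (rule inj_onI, clarify)
    fix i j i' j' :: 'a assume ne: "i \<noteq> j" "i' \<noteq> j'" and eq: "{#i, i, j#} = {#i', i', j'#}"
    \<comment> \<open>\<open>i\<close> occurs at least twice on the left, and on the right only
      \<open>i'\<close> does.\<close>
    have "i = i'"
      using arg_cong[OF eq, of "\<lambda>N. count N i"] ne by (simp split: if_splits)
    then show "i = i' \<and> j = j'"
      using eq by simp
  qed
  moreover have "inj_on ?f3 ?Q"
  proof (rule inj_onI)
    fix x y assume xy: "x \<in> ?Q" "y \<in> ?Q" "?f3 x = ?f3 y"
    obtain i j k i' j' k' where "x = (i, j, k)" "y = (i', j', k')"
      by (metis prod_cases3)
    moreover from this xy have "[i, j, k] = [i', j', k']"
      by (metis (mono_tags, lifting) case_prod_conv mem_Collect_eq sorted)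
    ultimately show "x = y"
      by simp
  qed
  moreover have "{#i, i, i#} \<noteq> {#i', i', j'#}" if "i' \<noteq> j'" for i i' j' :: 'a
  proof
    assume "{#i, i, i#} = {#i', i', j'#}"
    from arg_cong[OF this, of set_mset] that show False
      by auto
  qed
  moreover have "{#i, i, i'#} \<noteq> {#j, k, l#}" if "j < k" "k < l" for i i' j k l :: 'a
  proof
    assume "{#i, i, i'#} = {#j, k, l#}"
    from arg_cong[OF this, of "\<lambda>N. count N i"] that show False
      by (auto split: if_splits)
  qed
  ultimately have inj: "inj_on ?f1 A" "inj_on ?f2 ?P" "inj_on ?f3 ?Q"
    and disj: "?f1 ` A \<inter> (?f2 ` ?P \<union> ?f3 ` ?Q) = {}" "?f2 ` ?P \<inter> ?f3 ` ?Q = {}"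
    by auto
  have "(\<Sum>N | set_mset N \<subseteq> A \<and> size N = 3. f N) = sum f (?f1 ` A) + (sum f (?f2 ` ?P) + sum f (?f3 ` ?Q))"
    unfolding cover using assms fin disj by (subst sum.union_disjoint; simp)+
  then show ?thesis
    unfolding sum.reindex[OF inj(1)] sum.reindex[OF inj(2)] sum.reindex[OF inj(3)]
    by (simp add: comp_def case_prod_unfold add.assoc)
qed

lemma Tr3_eq_sum_trace3:
  assumes "m \<ge> 2"
  shows "Tr n m T 3 / of_nat (m - 1) ^ (n - 1) =
      (\<Sum>i=1..n. trace3 n m T i i i / fact (3 * (m - 1)))
    + (\<Sum>(i, j) | i \<in> {1..n} \<and> j \<in> {1..n} \<and> i \<noteq> j.
         trace3 n m T i i j / (fact (2 * (m - 1)) * fact (m - 1)))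
    + (\<Sum>(i, j, k) | i \<in> {1..n} \<and> j \<in> {1..n} \<and> k \<in> {1..n} \<and> i < j \<and> j < k.
         trace3 n m T i j k / fact (m - 1) ^ 3)"
proof -
  let ?f = "\<lambda>N. Poly_Mapping.lookup (Tr_summand n m T 3 (restrict (count N) {1..n})) 0"
  have "Tr n m T 3 / of_nat (m - 1) ^ (n - 1) = (\<Sum>N | set_mset N \<subseteq> {1..n} \<and> size N = 3. ?f N)"
    using assms by (simp add: Tr_def sum_compositions_eq_sum_multisets)
  also have "\<dots> = (\<Sum>i=1..n. trace3 n m T i i i / fact (3 * (m - 1)))
    + (\<Sum>(i, j) | i \<in> {1..n} \<and> j \<in> {1..n} \<and> i \<noteq> j.
         trace3 n m T i i j / (fact (2 * (m - 1)) * fact (m - 1)))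
    + (\<Sum>(i, j, k) | i \<in> {1..n} \<and> j \<in> {1..n} \<and> k \<in> {1..n} \<and> i < j \<and> j < k.
         trace3 n m T i j k / fact (m - 1) ^ 3)"
    unfolding sum_multisets_size3[OF finite_atLeastAtMost]
  proof (intro arg_cong2[where f = "(+)"] sum.cong refl, goal_cases)
    case (1 i)
    then show ?case
      using assms by (subst lookup_Tr_summand3) (simp_all add: numeral_3_eq_3 del: One_nat_def)
  next
    case (2 x)
    then show ?case
      using assms by (cases x) (clarsimp simp: lookup_Tr_summand3 numeral_2_eq_2 simp del: One_nat_def)
  next
    case (3 x)
    then show ?case
      using assms by (cases x) (clarsimp simp: lookup_Tr_summand3 power3_eq_cube simp del: One_nat_def)
  qed
  finally show ?thesis .
qed

section \<open>The contribution of a single vertex\<close>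

text \<open>All tails are \<open>i\<close>, so balance forces all heads to be \<open>i\<close>. The
  only closed walk on \<open>3 * (m - 1)\<close> loops is the constant one, and its weight cancels
  the factorial.\<close>

lemma trace3_same:
  assumes "m \<ge> 2" "i \<in> {1..n}"
  shows "trace3 n m T i i i / fact (3 * (m - 1)) = T (replicate m i) ^ 3"
proof -
  let ?M = "m - 1"
  let ?R = "replicate ?M i"
  have R: "?R \<in> tuples n ?M" "i # ?R = replicate m i"
    using assms by (auto simp: tuples_def simp flip: replicate_Suc)
  have weight: "walk_weight (arcs_from i ?R + arcs_from i ?R + arcs_from i ?R) = fact (3 * ?M)"
  proof -
    have E: "arcs_from i ?R + arcs_from i ?R + arcs_from i ?R = replicate_mset (3 * ?M) (i, i)"
      by (auto simp: arcs_from_def multiset_eq_iff)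
    have "{vs. closed_walk_arcs vs = replicate_mset K (i, i)} = {replicate K i}" for K
    proof (intro equalityI subsetI)
      fix vs assume "vs \<in> {vs. closed_walk_arcs vs = replicate_mset K (i, i)}"
      then have vs: "mset vs = replicate_mset K i"
        using image_fst_closed_walk_arcs[of vs] by simp
      have "length vs = K" "set vs \<subseteq> {i}"
        unfolding size_mset[symmetric] set_mset_mset[symmetric] vs by auto
      then show "vs \<in> {replicate K i}"
        by (auto intro: replicate_eqI)
    next
      fix vs assume "vs \<in> {replicate K i}"
      then show "vs \<in> {vs. closed_walk_arcs vs = replicate_mset K (i, i)}"
        by (simp add: closed_walk_arcs_def zip_replicate)
    qed
    then show ?thesis
      unfolding E walk_weight_def by (simp add: mset_fact_replicate)
  qed
  \<comment> \<open>The nested conditionals let the three sums collapse one at a time, innermost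
    first.\<close>
  have "T (i # x) * T (i # y) * T (i # z) * walk_weight (arcs_from i x + arcs_from i y + arcs_from i z)
      = (if x = ?R then if y = ?R then if z = ?R
         then T (replicate m i) ^ 3 * fact (3 * ?M) else 0 else 0 else 0)"
    if "x \<in> tuples n ?M" "y \<in> tuples n ?M" "z \<in> tuples n ?M" for x y z
  proof (cases "x = ?R \<and> y = ?R \<and> z = ?R")
    case True
    then show ?thesis
      using R weight by (simp add: power3_eq_cube)
  next
    case False
    have "walk_weight (arcs_from i x + arcs_from i y + arcs_from i z) = 0"
    proof (rule ccontr)
      assume "walk_weight (arcs_from i x + arcs_from i y + arcs_from i z) \<noteq> 0"
      from walk_weight_nonzero_balanced[OF this]
      have "mset x + mset y + mset z
          = replicate_mset (length x) i + replicate_mset (length y) i + replicate_mset (length z) i"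
        by simp
      from arg_cong[OF this, of set_mset] have "set x \<union> set y \<union> set z \<subseteq> {i}"
        by (auto split: if_splits)
      then have "x = ?R" "y = ?R" "z = ?R"
        using that by (auto intro!: replicate_eqI simp: tuples_def)
      then show False
        using False by simp
    qed
    then show ?thesis
      using False by auto
  qed
  then have "trace3 n m T i i i = (\<Sum>x\<in>tuples n ?M. \<Sum>y\<in>tuples n ?M. \<Sum>z\<in>tuples n ?M.
      (if x = ?R then if y = ?R then if z = ?R
         then T (replicate m i) ^ 3 * fact (3 * ?M) else 0 else 0 else 0))"
    unfolding trace3_def by (intro sum.cong refl)
  also have "\<dots> = (\<Sum>x\<in>tuples n ?M. \<Sum>y\<in>tuples n ?M.
      (if x = ?R then if y = ?R then T (replicate m i) ^ 3 * fact (3 * ?M) else 0 else 0))"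
    using R by (intro sum.cong refl) simp
  also have "\<dots> = (\<Sum>x\<in>tuples n ?M. if x = ?R then T (replicate m i) ^ 3 * fact (3 * ?M) else 0)"
    using R by (intro sum.cong refl) simp
  also have "\<dots> = T (replicate m i) ^ 3 * fact (3 * ?M)"
    using R by simp
  finally show ?thesis
    by simp
qed


section \<open>Counting closed walks on two vertices\<close>

text \<open>The start vertex \<open>u\<close> is not part of the list \<open>ws\<close>; the end vertex \<open>v\<close> is.\<close>

definition walks_between :: "'a \<Rightarrow> 'a \<Rightarrow> ('a \<times> 'a) multiset \<Rightarrow> 'a list set" where
  "walks_between u v E = {ws. mset (zip (u # ws) ws) = E \<and> last (u # ws) = v}"

lemma walks_between_empty: "walks_between u v {#} = (if u = v then {[]} else {})"
proof -
  have "mset (zip (u # ws) ws) = {#} \<longleftrightarrow> ws = []" for ws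
    by (cases ws) simp_all
  then show ?thesis
    by (auto simp: walks_between_def)
qed

lemma finite_walks_between: "finite (walks_between u v E)"
proof (rule finite_subset)
  show "walks_between u v E \<subseteq> {ws. set ws \<subseteq> snd ` set_mset E \<and> length ws = size E}"
  proof safe
    fix ws assume "ws \<in> walks_between u v E"
    then have E: "E = mset (zip (u # ws) ws)"
      by (simp add: walks_between_def)
    show "length ws = size E"
      by (simp add: E)
    have "map snd (zip (u # ws) ws) = ws"
      by (simp add: map_snd_zip_take)
    then show "x \<in> snd ` set_mset E" if "x \<in> set ws" for x
      using that unfolding E set_mset_mset by (metis list.set_map)
  qed
qed (simp add: finite_lists_length_eq)

text \<open>Walks are sorted by their first arc \<open>(u, x)\<close>; deleting it leaves a walk
  from \<open>x\<close> on the remaining arcs.\<close>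

lemma card_walks_between_step:
  assumes "E \<noteq> {#}"
  shows "card (walks_between u v E) = (\<Sum>x | (u, x) \<in># E. card (walks_between x v (E - {#(u, x)#})))"
proof -
  let ?X = "{x. (u, x) \<in># E}"
  have "?X \<subseteq> snd ` set_mset E"
    by force
  then have fin: "finite ?X"
    by (rule finite_subset) simp
  have "walks_between u v E = (\<Union>x\<in>?X. (#) x ` walks_between x v (E - {#(u, x)#}))"
  proof (intro equalityI subsetI)
    fix ws assume ws: "ws \<in> walks_between u v E"
    with assms obtain x ws' where "ws = x # ws'"
      by (cases ws) (auto simp: walks_between_def)
    then show "ws \<in> (\<Union>x\<in>?X. (#) x ` walks_between x v (E - {#(u, x)#}))"
      using ws by (auto simp: walks_between_def)
  next
    fix ws assume "ws \<in> (\<Union>x\<in>?X. (#) x ` walks_between x v (E - {#(u, x)#}))"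
    then show "ws \<in> walks_between u v E"
      by (auto simp: walks_between_def)
  qed
  also have "card \<dots> = (\<Sum>x\<in>?X. card ((#) x ` walks_between x v (E - {#(u, x)#})))"
    using fin by (intro card_UN_disjoint) (auto simp: finite_walks_between)
  also have "\<dots> = (\<Sum>x\<in>?X. card (walks_between x v (E - {#(u, x)#})))"
    by (intro sum.cong refl card_image) (simp add: inj_on_def)
  finally show ?thesis .
qed

definition two_vertex_arcs :: "'a \<Rightarrow> 'a \<Rightarrow> nat \<Rightarrow> nat \<Rightarrow> nat \<Rightarrow> nat \<Rightarrow> ('a \<times> 'a) multiset" where
  "two_vertex_arcs i j a s t b =
     replicate_mset a (i, i) + replicate_mset s (i, j) + replicate_mset t (j, i) + replicate_mset b (j, j)"

lemma two_vertex_arcs_swap: "two_vertex_arcs i j a s t b = two_vertex_arcs j i b t s a"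
  by (simp add: two_vertex_arcs_def add_ac)

lemma card_walks_two_vertices_step:
  assumes "i \<noteq> j" "a + s + t + b > 0"
  shows "card (walks_between i v (two_vertex_arcs i j a s t b)) =
     (if a > 0 then card (walks_between i v (two_vertex_arcs i j (a - 1) s t b)) else 0) +
     (if s > 0 then card (walks_between j v (two_vertex_arcs i j a (s - 1) t b)) else 0)"
proof -
  let ?E = "two_vertex_arcs i j"
  have del: "a > 0 \<Longrightarrow> ?E a s t b - {#(i, i)#} = ?E (a - 1) s t b"
    "s > 0 \<Longrightarrow> ?E a s t b - {#(i, j)#} = ?E a (s - 1) t b"
    by (cases a; cases s; simp add: two_vertex_arcs_def)+
  have succs: "{x. (i, x) \<in># ?E a s t b} = (if a > 0 then {i} else {}) \<union> (if s > 0 then {j} else {})"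
    using assms by (auto simp: two_vertex_arcs_def)
  have "?E a s t b \<noteq> {#}"
    using assms(2) by (auto simp: two_vertex_arcs_def)
  then show ?thesis
    unfolding card_walks_between_step[OF \<open>_ \<noteq> {#}\<close>] succs using assms del by auto
qed

text \<open>
  A walk from \<open>i\<close> to \<open>i\<close> has \<open>s + 1\<close> stays at \<open>i\<close> and \<open>s\<close> stays at \<open>j\<close>, one from \<open>j\<close> to \<open>i\<close> has
  \<open>s + 1\<close> stays at both; the binomial coefficients count the distributions of the loops.
\<close>

lemma card_walks_two_vertices:
  assumes "i \<noteq> j"
  shows "card (walks_between i i (two_vertex_arcs i j a s s b)) =
     (a + s choose s) * (if s = 0 then if b = 0 then 1 else 0 else (b + s - 1 choose (s - 1)))"
   and "card (walks_between j i (two_vertex_arcs i j a s (Suc s) b)) = (a + s choose s) * (b + s choose s)"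
proof -
  \<comment> \<open>Both counts are proved together by induction on the number of arcs, because a
    first step may lead from one situation to the other. For \<open>s = 0\<close> loops at
    \<open>j\<close> are unreachable from \<open>i\<close>, so only \<open>b = 0\<close> admits a
    walk.\<close>
  have "(a + s + s + b = N \<longrightarrow> card (walks_between i i (two_vertex_arcs i j a s s b)) =
     (a + s choose s) * (if s = 0 then if b = 0 then 1 else 0 else (b + s - 1 choose (s - 1)))) \<and>
    (a + s + Suc s + b = N \<longrightarrow> card (walks_between j i (two_vertex_arcs i j a s (Suc s) b)) =
     (a + s choose s) * (b + s choose s))" for N
  proof (induction N arbitrary: a s b)
    case 0
    then show ?case
      by (simp add: two_vertex_arcs_def walks_between_empty)
  next
    case (Suc N)
    \<comment> \<open>After an arc to \<open>j\<close>, there remain \<open>s - 1\<close> arcs to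
      \<open>j\<close> and \<open>s\<close> arcs back: the second situation with
      \<open>s - 1\<close> in place of \<open>s\<close>.\<close>
    have step_i: "card (walks_between i i (two_vertex_arcs i j a s s b)) =
       (if a > 0 then card (walks_between i i (two_vertex_arcs i j (a - 1) s s b)) else 0) +
       (if s > 0 then card (walks_between j i (two_vertex_arcs i j a (s - 1) s b)) else 0)"
      if "a + s + s + b = Suc N"
      using card_walks_two_vertices_step[OF assms, of a s s b i] that by simp
    have step_j: "card (walks_between j i (two_vertex_arcs i j a s (Suc s) b)) =
       (if b > 0 then card (walks_between j i (two_vertex_arcs i j a s (Suc s) (b - 1))) else 0) +
       card (walks_between i i (two_vertex_arcs i j a s s b))"
      using card_walks_two_vertices_step[OF assms[symmetric], of b "Suc s" s a i]
      by (simp add: two_vertex_arcs_swap[of j i])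
    have IH_i: "a + s + s + b = N \<Longrightarrow> card (walks_between i i (two_vertex_arcs i j a s s b)) =
     (a + s choose s) * (if s = 0 then if b = 0 then 1 else 0 else (b + s - 1 choose (s - 1)))" for a s b
      using Suc.IH by blast
    have IH_j: "a + s + Suc s + b = N \<Longrightarrow> card (walks_between j i (two_vertex_arcs i j a s (Suc s) b)) =
     (a + s choose s) * (b + s choose s)" for a s b
      using Suc.IH by blast
    show ?case
    proof (intro conjI impI)
      assume N: "a + s + s + b = Suc N"
      show "card (walks_between i i (two_vertex_arcs i j a s s b)) =
        (a + s choose s) * (if s = 0 then if b = 0 then 1 else 0 else (b + s - 1 choose (s - 1)))"
        \<comment> \<open>Here, as in the other case, the recursion is Pascal's rule for one of the
          two binomial factors.\<close>
        unfolding step_i[OF N] using N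
        by (cases a; cases s) (simp_all add: IH_i IH_j algebra_simps)
    next
      assume N: "a + s + Suc s + b = Suc N"
      show "card (walks_between j i (two_vertex_arcs i j a s (Suc s) b)) = (a + s choose s) * (b + s choose s)"
        unfolding step_j using N
        by (cases b; cases s) (simp_all add: IH_i IH_j algebra_simps)
    qed
  qed
  then show "card (walks_between i i (two_vertex_arcs i j a s s b)) =
     (a + s choose s) * (if s = 0 then if b = 0 then 1 else 0 else (b + s - 1 choose (s - 1)))"
   "card (walks_between j i (two_vertex_arcs i j a s (Suc s) b)) = (a + s choose s) * (b + s choose s)"
    by blast+
qed

text \<open>A closed walk lists its start but not the return to it, while
  \<open>walks_between\<close> lists the end but not the start; \<open>rotate1\<close> translates. A
  nonempty \<open>E\<close> excludes the empty list, whose \<open>hd\<close> is unspecified.\<close>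

lemma card_closed_walks_from:
  assumes "E \<noteq> {#}"
  shows "card {vs. hd vs = u \<and> closed_walk_arcs vs = E} = card (walks_between u u E)"
proof (rule bij_betw_same_card[of rotate1], rule bij_betw_byWitness[where f' = "\<lambda>ws. u # butlast ws"])
  have rot: "closed_walk_arcs (u # us) = mset (zip (u # us @ [u]) (us @ [u]))" for us
  proof -
    have "zip (u # us @ [u]) (us @ [u]) = zip ((u # us) @ [u]) (us @ [u])"
      by simp
    also have "\<dots> = zip (u # us) (us @ [u])"
      by (subst zip_append1) simp
    finally show ?thesis
      by (simp add: closed_walk_arcs_def)
  qed
  have vs: "\<exists>us. vs = u # us" if "hd vs = u" "closed_walk_arcs vs = E" for vs
  proof -
    have "vs \<noteq> []"
      using that assms by (auto simp: closed_walk_arcs_def)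
    then show ?thesis
      using that(1) by (cases vs) auto
  qed
  have ws: "\<exists>us. ws = us @ [u]" if "ws \<in> walks_between u u E" for ws
  proof -
    have "ws \<noteq> []"
      using that assms by (auto simp: walks_between_def)
    then have "last ws = u"
      using that by (simp add: walks_between_def)
    then show ?thesis
      using \<open>ws \<noteq> []\<close> by (metis append_butlast_last_id)
  qed
  show "\<forall>vs\<in>{vs. hd vs = u \<and> closed_walk_arcs vs = E}. u # butlast (rotate1 vs) = vs"
  proof
    fix vs assume "vs \<in> {vs. hd vs = u \<and> closed_walk_arcs vs = E}"
    then obtain us where "vs = u # us"
      using vs by blast
    then show "u # butlast (rotate1 vs) = vs"
      by simp
  qed
  show "\<forall>ws\<in>walks_between u u E. rotate1 (u # butlast ws) = ws"
    by (auto dest!: ws)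
  show "rotate1 ` {vs. hd vs = u \<and> closed_walk_arcs vs = E} \<subseteq> walks_between u u E"
  proof (rule image_subsetI)
    fix vs assume E: "vs \<in> {vs. hd vs = u \<and> closed_walk_arcs vs = E}"
    then obtain us where "vs = u # us"
      using vs by blast
    then show "rotate1 vs \<in> walks_between u u E"
      using E by (simp add: walks_between_def rot)
  qed
  show "(\<lambda>ws. u # butlast ws) ` walks_between u u E \<subseteq> {vs. hd vs = u \<and> closed_walk_arcs vs = E}"
  proof safe
    fix ws assume "ws \<in> walks_between u u E"
    moreover from ws[OF this] obtain us where "ws = us @ [u]"
      by blast
    ultimately show "closed_walk_arcs (u # butlast ws) = E"
      by (simp add: rot walks_between_def)
  qed simp
qed

text \<open>The two summands count the walks starting at \<open>i\<close> and at \<open>j\<close>.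
  If \<open>s = 0\<close>, the assumptions put loops at both vertices, and no walk can connect
  them.\<close>

lemma card_closed_walks_two_vertices:
  assumes "i \<noteq> j" "a > 0" "b > 0 \<or> s > 0"
  shows "card {vs. closed_walk_arcs vs = two_vertex_arcs i j a s s b} =
     (if s = 0 then 0
      else (a + s choose s) * (b + s - 1 choose (s - 1)) + (b + s choose s) * (a + s - 1 choose (s - 1)))"
proof -
  let ?E = "two_vertex_arcs i j a s s b"
  have ne: "?E \<noteq> {#}"
    using assms(2) by (auto simp: two_vertex_arcs_def)
  have "hd vs = i \<or> hd vs = j" if "closed_walk_arcs vs = ?E" for vs
  proof -
    have "mset vs = image_mset fst ?E"
      using image_fst_closed_walk_arcs[of vs] that by simp
    then have "set vs = fst ` set_mset ?E"
      by (metis set_image_mset set_mset_mset)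
    then have "set vs \<subseteq> {i, j}" "vs \<noteq> []"
      using ne by (auto simp: two_vertex_arcs_def split: if_splits)
    then show ?thesis
      using hd_in_set by blast
  qed
  then have union: "{vs. closed_walk_arcs vs = ?E} =
      {vs. hd vs = i \<and> closed_walk_arcs vs = ?E} \<union> {vs. hd vs = j \<and> closed_walk_arcs vs = ?E}"
    by blast
  have "finite {vs. closed_walk_arcs vs = ?E}"
  proof -
    obtain us where "mset us = image_mset fst ?E"
      using ex_mset by blast
    then have "{vs. closed_walk_arcs vs = ?E} \<subseteq> {vs. mset vs = mset us}"
      by (auto simp flip: image_fst_closed_walk_arcs)
    then show ?thesis
      by (rule finite_subset) (rule mset_eq_finite)
  qed
  then have "finite {vs. hd vs = i \<and> closed_walk_arcs vs = ?E}"
    "finite {vs. hd vs = j \<and> closed_walk_arcs vs = ?E}"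
    by (rule rev_finite_subset; blast)+
  moreover have "{vs. hd vs = i \<and> closed_walk_arcs vs = ?E} \<inter> {vs. hd vs = j \<and> closed_walk_arcs vs = ?E} = {}"
    using assms(1) by blast
  ultimately have "card {vs. closed_walk_arcs vs = ?E} =
      card {vs. hd vs = i \<and> closed_walk_arcs vs = ?E} + card {vs. hd vs = j \<and> closed_walk_arcs vs = ?E}"
    unfolding union by (rule card_Un_disjoint)
  also have "\<dots> = card (walks_between i i ?E) + card (walks_between j j (two_vertex_arcs j i b s s a))"
    by (simp add: card_closed_walks_from ne two_vertex_arcs_swap[of j i])
  finally show ?thesis
    using assms by (auto simp: card_walks_two_vertices)
qed


section \<open>The contribution of two vertices\<close>

text \<open>For distinct keys no exponents add up, so they are exactly the multiplicities; equality
  with a count also excludes negative exponents.\<close>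

lemma mset_powers_iff_count:
  assumes "distinct (map fst ars)"
  shows "mset_powers A ars \<longleftrightarrow>
    set_mset A \<subseteq> fst ` set ars \<and> (\<forall>(a, r)\<in>set ars. int (count A a) = r)"
proof -
  let ?S = "\<Sum>(a, r)\<leftarrow>ars. replicate_mset (nat r) a"
  have out: "count (\<Sum>(a, r)\<leftarrow>ars. replicate_mset (nat r) a) v = 0" if "v \<notin> fst ` set ars"
    for v and ars :: "('a \<times> int) list"
    using that by (induction ars) auto
  have count: "count ?S a = nat r" if "(a, r) \<in> set ars" for a r
    using assms that by (induction ars) (auto simp: out image_iff)
  show ?thesis
  proof
    assume A: "mset_powers A ars"
    then show "set_mset A \<subseteq> fst ` set ars \<and> (\<forall>(a, r)\<in>set ars. int (count A a) = r)"
      using set_mset_powers[OF A] by (fastforce simp: mset_powers_def count)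
  next
    assume A: "set_mset A \<subseteq> fst ` set ars \<and> (\<forall>(a, r)\<in>set ars. int (count A a) = r)"
    have "A = ?S"
    proof (rule multiset_eqI)
      fix v
      show "count A v = count ?S v"
      proof (cases "v \<in> fst ` set ars")
        case True
        then obtain r where "(v, r) \<in> set ars"
          by force
        then show ?thesis
          using A by (fastforce simp: count)
      next
        case False
        then show ?thesis
          using A by (metis in_mono not_in_iff out)
      qed
    qed
    moreover have "0 \<le> r" if "(a, r) \<in> set ars" for a r
      using A that by fastforce
    ultimately show "mset_powers A ars"
      by (auto simp: mset_powers_def)
  qed
qed

lemma mset_powers_pair_iff:
  assumes "i \<noteq> j"
  shows "mset_powers A [(i, a), (j, b)] \<longleftrightarrow>
    set_mset A \<subseteq> {i, j} \<and> int (count A i) = a \<and> int (count A j) = b"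
  using assms by (simp add: mset_powers_iff_count)

lemma mset_powers_triple_iff:
  assumes "i \<noteq> j" "i \<noteq> k" "j \<noteq> k"
  shows "mset_powers A [(i, a), (j, b), (k, c)] \<longleftrightarrow>
    set_mset A \<subseteq> {i, j, k} \<and> int (count A i) = a \<and> int (count A j) = b \<and> int (count A k) = c"
  using assms by (simp add: mset_powers_iff_count)

lemma size_eq_count3:
  assumes "i \<noteq> j" "i \<noteq> k" "j \<noteq> k" "set_mset A \<subseteq> {i, j, k}"
  shows "size A = count A i + count A j + count A k"
proof -
  have "size A = sum (count A) {i, j, k}"
    unfolding size_multiset_overloaded_eq using assms(4)
    by (intro sum.mono_neutral_left) (auto simp: not_in_iff)
  then show ?thesis
    using assms by simp
qed

text \<open>The factorials of the arcs are \<open>fact (2 * M) * fact M\<close> divided by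
  \<open>(2 * M choose s) * (M choose s)\<close>. Relative to this product of binomials, the walks
  starting at \<open>i\<close> number \<open>s / M\<close> and those starting at \<open>j\<close>
  number \<open>s / (2 * M)\<close>, which add up to \<open>3 * s / (2 * M)\<close>.\<close>

lemma walk_weight_two_vertices:
  assumes "i \<noteq> j" "M > 0" "s \<le> M"
    and xy: "mset x + mset y = replicate_mset s j + replicate_mset (2 * M - s) i"
    and z: "mset z = replicate_mset s i + replicate_mset (M - s) j"
  shows "walk_weight (arcs_from i x + arcs_from i y + arcs_from j z) / (fact (2 * M) * fact M)
       = of_nat (3 * s) / of_nat (2 * M)"
proof -
  let ?E = "arcs_from i x + arcs_from i y + arcs_from j z"
  have E_split: "?E = image_mset (Pair i) (mset x + mset y) + image_mset (Pair j) (mset z)"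
    by (simp add: arcs_from_def)
  have E: "?E = two_vertex_arcs i j (2 * M - s) s s (M - s)"
    unfolding E_split xy z by (simp add: two_vertex_arcs_def add_ac)
  have "mset_fact ?E = mset_fact (mset x + mset y) * mset_fact (mset z)"
    unfolding E_split using assms(1)
    by (subst mset_fact_add) (auto simp only: mset_fact_image_Pair set_image_mset)
  also have "\<dots> = fact s * fact (2 * M - s) * (fact s * fact (M - s))"
    unfolding xy z using assms(1) by (subst mset_fact_add; auto simp: mset_fact_replicate)+
  finally have F: "mset_fact ?E = fact s * fact (2 * M - s) * (fact s * fact (M - s))" .
  show ?thesis
  proof (cases s)
    case 0
    then show ?thesis
      unfolding walk_weight_def F using assms by (simp add: E card_closed_walks_two_vertices)
  next
    case (Suc s')
    obtain N where N: "M = Suc N"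
      using assms(2) gr0_implies_Suc by blast
    have card: "card {vs. closed_walk_arcs vs = ?E} =
        (2 * M choose s) * (N choose s') + (M choose s) * (Suc (2 * N) choose s')"
      unfolding E using assms Suc N by (subst card_closed_walks_two_vertices) auto
    have choose_fact: "of_nat (a choose b) = (fact a / (fact b * fact (a - b)) :: complex)" if "b \<le> a" for a b
      using that by (simp add: binomial_fact)
    have "s' \<le> N"
      using assms(3) Suc N by simp
    then have *: "of_nat (2 * M choose s) = (fact (2 * M) / (fact s * fact (2 * M - s)) :: complex)"
      "of_nat (M choose s) = (fact M / (fact s * fact (M - s)) :: complex)"
      "of_nat (N choose s') = (fact N / (fact s' * fact (M - s)) :: complex)"
      "of_nat (Suc (2 * N) choose s') = (fact (Suc (2 * N)) / (fact s' * fact (2 * M - s)) :: complex)"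
    proof -
      have "N - s' = M - s" "Suc (2 * N) - s' = 2 * M - s"
        using Suc N by simp_all
      then show "of_nat (N choose s') = (fact N / (fact s' * fact (M - s)) :: complex)"
        "of_nat (Suc (2 * N) choose s') = (fact (Suc (2 * N)) / (fact s' * fact (2 * M - s)) :: complex)"
        using choose_fact[of s' N] choose_fact[of s' "Suc (2 * N)"] \<open>s' \<le> N\<close> by simp_all
    qed (use assms(3) in \<open>simp_all add: choose_fact\<close>)
    have f: "(fact s :: complex) = of_nat s * fact s'" "(fact M :: complex) = of_nat M * fact N"
      "(fact (2 * M) :: complex) = of_nat (2 * M) * fact (Suc (2 * N))"
      using Suc N by (simp_all add: fact_reduce del: of_nat_Suc of_nat_mult)
    have "of_nat s \<noteq> (0 :: complex)" "of_nat M \<noteq> (0 :: complex)"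
      unfolding of_nat_eq_0_iff using Suc N by simp_all
    then show ?thesis
      unfolding walk_weight_def F card of_nat_add of_nat_mult * f
      by (simp add: field_simps del: fact_Suc of_nat_Suc)
  qed
qed

text \<open>Balance makes the number of arcs from \<open>i\<close> to \<open>j\<close> equal to the
  number back. This common value \<open>s\<close> determines the weight, so the tuples are grouped
  by it.\<close>

lemma trace3_two:
  assumes "m \<ge> 2" "i \<noteq> j"
  shows "trace3 n m T i i j / (fact (2 * (m - 1)) * fact (m - 1)) =
    (\<Sum>s=0..m - 1. of_nat (3 * s) / of_nat (2 * (m - 1))
         * entry_pair_sum n m T i [(j, int s), (i, 2 * (int m - 1) - int s)]
         * entry_sum n m T j [(i, int s), (j, int m - 1 - int s)])"
proof -
  let ?M = "m - 1"
  let ?X = "tuples n ?M"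
  let ?c = "\<lambda>s. of_nat (3 * s) / of_nat (2 * ?M) :: complex"
  let ?A = "\<lambda>s x y. mset_powers (mset x + mset y) [(j, int s), (i, 2 * (int m - 1) - int s)]"
  let ?B = "\<lambda>s z. mset_powers (mset z) [(i, int s), (j, int m - 1 - int s)]"
  let ?w = "\<lambda>x y z. walk_weight (arcs_from i x + arcs_from i y + arcs_from j z) / (fact (2 * ?M) * fact ?M)"
  have int_M: "int m - 1 = int ?M"
    using assms(1) by simp
  have A: "?A s x y \<longleftrightarrow> mset x + mset y = replicate_mset s j + replicate_mset (2 * ?M - s) i"
    and B: "?B s z \<longleftrightarrow> mset z = replicate_mset s i + replicate_mset (?M - s) j"
    if "s \<le> ?M" for s x y z
    using that unfolding int_M by (auto simp: mset_powers_def nat_diff_distrib nat_mult_distrib)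
  \<comment> \<open>At most one term of this sum is nonzero. Writing the weight as a sum over
    \<open>s\<close> allows the sum over \<open>s\<close> to be moved outside.\<close>
  have weight: "?w x y z = (\<Sum>s=0..?M. if ?A s x y \<and> ?B s z then ?c s else 0)"
    if "x \<in> ?X" "y \<in> ?X" "z \<in> ?X" for x y z
  proof -
    have B_count: "s = count (mset z) i" if "?B s z" for s
      using that unfolding mset_powers_pair_iff[OF assms(2)] by simp
    have w: "?w x y z = ?c s" if "?A s x y" "?B s z" "s \<le> ?M" for s
      using that A B assms by (intro walk_weight_two_vertices) auto
    \<comment> \<open>The only candidate for \<open>s\<close> is the number of arcs from
      \<open>j\<close> to \<open>i\<close>.\<close>
    define s0 where "s0 = count (mset z) i"
    have "s0 \<le> ?M"
      unfolding s0_def using \<open>z \<in> ?X\<close> tuples_length count_le_size[of "mset z" i] by fastforce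
    show ?thesis
    proof (cases "?A s0 x y \<and> ?B s0 z")
      case True
      have "(\<Sum>s=0..?M. if ?A s x y \<and> ?B s z then ?c s else 0) = (\<Sum>s=0..?M. if s = s0 then ?c s else 0)"
        using True B_count by (intro sum.cong refl) (auto simp: s0_def)
      then show ?thesis
        using \<open>s0 \<le> ?M\<close> w[of s0] True by simp
    next
      case False
      have "?w x y z = 0"
      proof (rule ccontr)
        assume "?w x y z \<noteq> 0"
        then have "walk_weight (arcs_from i x + arcs_from i y + arcs_from j z) \<noteq> 0"
          by auto
        from walk_weight_nonzero_balanced[OF this]
        have bal: "mset x + mset y + mset z
            = replicate_mset ?M i + replicate_mset ?M i + replicate_mset ?M j"
          using that by (simp add: tuples_length)
        have cnt: "count (mset x) v + count (mset y) v + count (mset z) v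
            = (if v = i then ?M else 0) + (if v = i then ?M else 0) + (if v = j then ?M else 0)" for v
          using arg_cong[OF bal, of "\<lambda>N. count N v"] by simp
        have sub: "set_mset (mset x + mset y) \<subseteq> {j, i}" "set_mset (mset z) \<subseteq> {i, j}"
          using arg_cong[OF bal, of set_mset] by (auto split: if_splits)
        have "size (mset z) = sum (count (mset z)) {i, j}"
          unfolding size_multiset_overloaded_eq using sub(2)
          by (intro sum.mono_neutral_left) (auto simp: count_list_0_iff)
        then have "count (mset z) i + count (mset z) j = ?M"
          using that assms(2) by (simp add: tuples_length)
        then have "?A s0 x y" "?B s0 z"
          unfolding mset_powers_pair_iff[OF assms(2)] mset_powers_pair_iff[OF assms(2)[symmetric]] int_M
          using sub cnt[of i] cnt[of j] assms(2) by (auto simp: s0_def)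
        then show False
          using False by blast
      qed
      moreover have "(\<Sum>s=0..?M. if ?A s x y \<and> ?B s z then ?c s else 0) = 0"
        using False B_count by (intro sum.neutral) (auto simp: s0_def)
      ultimately show ?thesis
        by simp
    qed
  qed
  have pair: "entry_pair_sum n m T i [(j, int s), (i, 2 * (int m - 1) - int s)]
      = (\<Sum>x\<in>?X. \<Sum>y\<in>?X. if ?A s x y then T (i # x) * T (i # y) else 0)" for s
  proof -
    have "{(x, y). x \<in> ?X \<and> y \<in> ?X \<and> ?A s x y} = {p \<in> ?X \<times> ?X. ?A s (fst p) (snd p)}"
      by auto
    then show ?thesis
      unfolding entry_pair_sum_def by (simp only: sum.cartesian_product) (simp add: sum.inter_filter case_prod_unfold)
  qed
  have single: "entry_sum n m T j [(i, int s), (j, int m - 1 - int s)]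
      = (\<Sum>z\<in>?X. if ?B s z then T (j # z) else 0)" for s
    unfolding entry_sum_def by (simp add: sum.inter_filter)
  have "trace3 n m T i i j / (fact (2 * ?M) * fact ?M)
      = (\<Sum>x\<in>?X. \<Sum>y\<in>?X. \<Sum>z\<in>?X. T (i # x) * T (i # y) * T (j # z) * ?w x y z)"
    unfolding trace3_def by (simp add: sum_divide_distrib)
  also have "\<dots> = (\<Sum>x\<in>?X. \<Sum>y\<in>?X. \<Sum>z\<in>?X. \<Sum>s=0..?M.
      T (i # x) * T (i # y) * T (j # z) * (if ?A s x y \<and> ?B s z then ?c s else 0))"
    by (intro sum.cong refl) (simp only: weight sum_distrib_left)
  also have "\<dots> = (\<Sum>s=0..?M. \<Sum>x\<in>?X. \<Sum>y\<in>?X. \<Sum>z\<in>?X.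
      T (i # x) * T (i # y) * T (j # z) * (if ?A s x y \<and> ?B s z then ?c s else 0))"
    by (simp only: sum.swap[of _ "{0..?M}" ?X])
  also have "\<dots> = (\<Sum>s=0..?M. \<Sum>x\<in>?X. \<Sum>y\<in>?X. \<Sum>z\<in>?X.
      ?c s * (if ?A s x y then T (i # x) * T (i # y) else 0) * (if ?B s z then T (j # z) else 0))"
    by (intro sum.cong refl) simp
  also have "\<dots> = (\<Sum>s=0..?M. ?c s
         * entry_pair_sum n m T i [(j, int s), (i, 2 * (int m - 1) - int s)]
         * entry_sum n m T j [(i, int s), (j, int m - 1 - int s)])"
    unfolding pair single mult.assoc sum_distrib_right unfolding sum_distrib_left mult.assoc ..
  finally show ?thesis .
qed


section \<open>The contribution of three vertices\<close>

text \<open>The condition has to single out the index only for \<open>v \<noteq> 0\<close>, because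
  an unbalanced choice of tuples has weight zero but may match no parameters.\<close>

lemma sum_unique4:
  fixes v :: "'b :: comm_monoid_add"
  assumes "p0 \<in> A" "q0 \<in> A" "r0 \<in> A" "s0 \<in> A" "finite A"
    and "\<And>p q r s. v \<noteq> 0 \<Longrightarrow> C p q r s \<longleftrightarrow> p = p0 \<and> q = q0 \<and> r = r0 \<and> s = s0"
  shows "(\<Sum>p\<in>A. \<Sum>q\<in>A. \<Sum>r\<in>A. \<Sum>s\<in>A. if C p q r s then v else 0) = v"
proof (cases "v = 0")
  case False
  have "(\<Sum>p\<in>A. \<Sum>q\<in>A. \<Sum>r\<in>A. \<Sum>s\<in>A. if C p q r s then v else 0)
      = (\<Sum>p\<in>A. \<Sum>q\<in>A. \<Sum>r\<in>A. \<Sum>s\<in>A. if s = s0 then if p = p0 \<and> q = q0 \<and> r = r0 then v else 0 else 0)"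
    by (intro sum.cong refl) (simp add: assms(6)[OF False])
  also have "\<dots> = (\<Sum>p\<in>A. \<Sum>q\<in>A. \<Sum>r\<in>A. if r = r0 then if p = p0 \<and> q = q0 then v else 0 else 0)"
    using assms by (intro sum.cong refl) simp
  also have "\<dots> = (\<Sum>p\<in>A. \<Sum>q\<in>A. if q = q0 then if p = p0 then v else 0 else 0)"
    using assms by (intro sum.cong refl) simp
  also have "\<dots> = (\<Sum>p\<in>A. if p = p0 then v else 0)"
    using assms by (intro sum.cong refl) simp
  finally show ?thesis
    using assms by simp
qed (simp cong: if_cong)

lemma mset_fact_three:
  assumes "i \<noteq> j" "i \<noteq> k" "j \<noteq> k" "set_mset A \<subseteq> {i, j, k}"
  shows "mset_fact A = fact (count A i) * fact (count A j) * fact (count A k)"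
proof -
  have "mset_fact A = (\<Prod>v\<in>{i, j, k}. fact (count A v))"
    unfolding mset_fact_def using assms(4) by (intro prod.mono_neutral_left) (auto simp: not_in_iff)
  then show ?thesis
    using assms by (simp add: mult_ac)
qed

lemma count_arcs_from: "count (arcs_from i x) (u, v) = (if u = i then count (mset x) v else 0)"
  unfolding arcs_from_def by (induction x) auto

text \<open>The exponents are those of the three entry sums in \<^const>\<open>t3\<close>.\<close>

definition compatible ::
  "nat \<Rightarrow> nat \<Rightarrow> nat \<Rightarrow> nat \<Rightarrow> nat \<Rightarrow> nat \<Rightarrow> nat \<Rightarrow> nat \<Rightarrow> nat list \<Rightarrow> nat list \<Rightarrow> nat list \<Rightarrow> bool" where
  "compatible m i j k p q r s x y z \<longleftrightarrow>
     mset_powers (mset x) [(i, int m - 1 - (int p + (int r + int s - int p))), (j, int p), (k, int r + int s - int p)] \<and>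
     mset_powers (mset y) [(i, int s), (j, int m - 1 - (int s + int q)), (k, int q)] \<and>
     mset_powers (mset z) [(i, int r), (j, int q + int s - int p), (k, int m - 1 - (int r + (int q + int s - int p)))]"

text \<open>The tuples determine \<open>p\<close>, \<open>q\<close>, \<open>r\<close>,
  \<open>s\<close>, which gives uniqueness of the parameters. The other five multiplicities follow
  from these four.\<close>

lemma compatible_iff_count:
  assumes "i \<noteq> j" "i \<noteq> k" "j \<noteq> k"
  shows "compatible m i j k p q r s x y z \<longleftrightarrow>
    set x \<subseteq> {i, j, k} \<and> set y \<subseteq> {i, j, k} \<and> set z \<subseteq> {i, j, k} \<and>
    count (mset x) j = p \<and> count (mset y) k = q \<and> count (mset z) i = r \<and> count (mset y) i = s \<and>
    int (count (mset x) i) = int m - 1 - int r - int s \<and> count (mset x) k + p = r + s \<and>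
    int (count (mset y) j) = int m - 1 - int s - int q \<and>
    count (mset z) j + p = q + s \<and> int (count (mset z) k) = int m - 1 + int p - int r - int q - int s"
  unfolding compatible_def mset_powers_triple_iff[OF assms] set_mset_mset by auto

lemma mset_powers_E:
  assumes ijk: "i \<noteq> j" "i \<noteq> k" "j \<noteq> k" and "compatible m i j k p q r s x y z"
  shows "mset_powers (arcs_from i x + arcs_from j y + arcs_from k z)
    (E_powers m i j k (int p) (int q) (int r) (int s))"
proof -
  note c = assms(4)[unfolded compatible_iff_count[OF ijk]]
  have "distinct (map fst (E_powers m i j k (int p) (int q) (int r) (int s)))"
    using ijk by (simp add: E_powers_def)
  moreover have "set_mset (arcs_from i x + arcs_from j y + arcs_from k z)
      \<subseteq> fst ` set (E_powers m i j k (int p) (int q) (int r) (int s))"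
    using c by (auto simp: arcs_from_def E_powers_def)
  moreover have "\<forall>(a, e)\<in>set (E_powers m i j k (int p) (int q) (int r) (int s)).
      int (count (arcs_from i x + arcs_from j y + arcs_from k z) a) = e"
    using ijk c by (simp add: E_powers_def count_arcs_from)
  ultimately show ?thesis
    by (simp add: mset_powers_iff_count)
qed

text \<open>The three groups of arcs have different tails, so their factorials multiply. The
  remaining count is \<open>w\<close> because it does not depend on the names of the
  vertices.\<close>

lemma walk_weight_compatible:
  assumes ijk: "i \<noteq> j" "i \<noteq> k" "j \<noteq> k" and comp: "compatible m i j k p q r s x y z"
  shows "walk_weight (arcs_from i x + arcs_from j y + arcs_from k z)
       = mset_fact (mset x) * mset_fact (mset y) * mset_fact (mset z) * of_nat (w m p q r s)"
proof -
  let ?E = "arcs_from i x + arcs_from j y + arcs_from k z"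
  have "set_mset (arcs_from i x) \<inter> set_mset (arcs_from j y) = {}"
    "set_mset (arcs_from i x + arcs_from j y) \<inter> set_mset (arcs_from k z) = {}"
    using ijk by (auto simp: arcs_from_def)
  then have "mset_fact ?E = mset_fact (mset x) * mset_fact (mset y) * mset_fact (mset z)"
    by (simp only: mset_fact_add mset_fact_arcs_from)
  moreover have "walks_with_arcs (E_powers m i j k (int p) (int q) (int r) (int s)) = {vs. closed_walk_arcs vs = ?E}"
    using mset_powers_E[OF assms] by (auto simp: walks_with_arcs_def mset_powers_def)
  ultimately show ?thesis
    by (simp add: walk_weight_def w_eq[OF ijk])
qed

text \<open>Both sides contain the same nine factorials of arc multiplicities: the trinomials group
  the arcs by head, the tuples group them by tail. Compatibility ensures that no subtraction
  truncates.\<close>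

lemma trinomial_compatible:
  assumes ijk: "i \<noteq> j" "i \<noteq> k" "j \<noteq> k" and comp: "compatible m i j k p q r s x y z"
  shows "1 / (trinomial (m - 1) s r * trinomial (m - 1) p (q + s - p) * trinomial (m - 1) q (r + s - p))
       = mset_fact (mset x) * mset_fact (mset y) * mset_fact (mset z) / fact (m - 1) ^ 3"
proof -
  note c = comp[unfolded compatible_iff_count[OF ijk]]
  have "m - 1 - s - r = count (mset x) i" "m - 1 - p - count (mset z) j = count (mset y) j"
    "m - 1 - q - count (mset x) k = count (mset z) k" "q + s - p = count (mset z) j" "r + s - p = count (mset x) k"
    using c by linarith+
  moreover have "mset_fact (mset x) = fact (count (mset x) i) * fact p * fact (count (mset x) k)"
    "mset_fact (mset y) = fact s * fact (count (mset y) j) * fact q"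
    "mset_fact (mset z) = fact r * fact (count (mset z) j) * fact (count (mset z) k)"
    using c by (simp_all add: mset_fact_three[OF ijk])
  ultimately show ?thesis
    by (simp only: trinomial_def) (simp add: power3_eq_cube)
qed

text \<open>The multiplicities form a 3 by 3 array whose row sums (tuple lengths) and column sums
  (balance) are all \<open>m - 1\<close>. Four suitably placed entries determine such an
  array.\<close>

lemma balanced_compatible:
  assumes ijk: "i \<noteq> j" "i \<noteq> k" "j \<noteq> k" and m: "m \<ge> 2"
    and len: "length x = m - 1" "length y = m - 1" "length z = m - 1"
    and "walk_weight (arcs_from i x + arcs_from j y + arcs_from k z) \<noteq> 0"
  shows "compatible m i j k (count (mset x) j) (count (mset y) k) (count (mset z) i) (count (mset y) i) x y z"
proof -
  have bal: "mset x + mset y + mset z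
      = replicate_mset (m - 1) i + replicate_mset (m - 1) j + replicate_mset (m - 1) k"
    using walk_weight_nonzero_balanced[OF assms(8)] len by simp
  have cnt: "count (mset x) v + count (mset y) v + count (mset z) v
      = (if v = i then m - 1 else 0) + (if v = j then m - 1 else 0) + (if v = k then m - 1 else 0)" for v
    using arg_cong[OF bal, of "\<lambda>N. count N v"] by simp
  have sub: "set x \<subseteq> {i, j, k}" "set y \<subseteq> {i, j, k}" "set z \<subseteq> {i, j, k}"
    using arg_cong[OF bal, of set_mset] by (auto split: if_splits)
  have "count (mset x) i + count (mset x) j + count (mset x) k = m - 1"
    "count (mset y) i + count (mset y) j + count (mset y) k = m - 1"
    "count (mset z) i + count (mset z) j + count (mset z) k = m - 1"
    using size_eq_count3[OF ijk, of "mset x"] size_eq_count3[OF ijk, of "mset y"]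
      size_eq_count3[OF ijk, of "mset z"] sub len by simp_all
  then show ?thesis
    unfolding compatible_iff_count[OF ijk] using sub cnt[of i] cnt[of j] cnt[of k] ijk m
    by simp arith
qed

lemma trace3_distinct:
  assumes m: "m \<ge> 2" and ijk: "i \<noteq> j" "i \<noteq> k" "j \<noteq> k"
  shows "trace3 n m T i j k / fact (m - 1) ^ 3 =
    (\<Sum>p=0..m - 1. \<Sum>q=0..m - 1. \<Sum>r=0..m - 1. \<Sum>s=0..m - 1.
           if w m p q r s = 0 then 0
           else of_nat (w m p q r s) * t3 n m T i j k (int p) (int q) (int r) (int s)
                / (trinomial (m - 1) s r * trinomial (m - 1) p (q + s - p)
                   * trinomial (m - 1) q (r + s - p)))"
proof -
  let ?M = "m - 1"
  let ?X = "tuples n ?M"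
  let ?w = "\<lambda>x y z. walk_weight (arcs_from i x + arcs_from j y + arcs_from k z) / fact ?M ^ 3"
  let ?v = "\<lambda>x y z. T (i # x) * T (j # y) * T (k # z) * ?w x y z"
  let ?c = "\<lambda>p q r s. 1 / (trinomial ?M s r * trinomial ?M p (q + s - p) * trinomial ?M q (r + s - p))"
  let ?A = "\<lambda>p q r s x. mset_powers (mset x)
    [(i, int m - 1 - (int p + (int r + int s - int p))), (j, int p), (k, int r + int s - int p)]"
  let ?B = "\<lambda>p q r s y. mset_powers (mset y) [(i, int s), (j, int m - 1 - (int s + int q)), (k, int q)]"
  let ?C = "\<lambda>p q r s z. mset_powers (mset z)
    [(i, int r), (j, int q + int s - int p), (k, int m - 1 - (int r + (int q + int s - int p)))]"
  have t3: "t3 n m T i j k (int p) (int q) (int r) (int s) = (\<Sum>x\<in>?X. \<Sum>y\<in>?X. \<Sum>z\<in>?X.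
      if compatible m i j k p q r s x y z then T (i # x) * T (j # y) * T (k # z) else 0)" for p q r s
  proof -
    have "t3 n m T i j k (int p) (int q) (int r) (int s) =
        (\<Sum>x\<in>?X. if ?A p q r s x then T (i # x) else 0) *
        (\<Sum>y\<in>?X. if ?B p q r s y then T (j # y) else 0) *
        (\<Sum>z\<in>?X. if ?C p q r s z then T (k # z) else 0)"
      unfolding t3_def entry_sum_def by (simp only: sum.inter_filter finite_tuples)
    also have "\<dots> = (\<Sum>x\<in>?X. \<Sum>y\<in>?X. \<Sum>z\<in>?X. (if ?A p q r s x then T (i # x) else 0) *
        (if ?B p q r s y then T (j # y) else 0) * (if ?C p q r s z then T (k # z) else 0))"
      unfolding mult.assoc sum_distrib_right unfolding sum_distrib_left mult.assoc ..
    also have "\<dots> = (\<Sum>x\<in>?X. \<Sum>y\<in>?X. \<Sum>z\<in>?X.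
        if compatible m i j k p q r s x y z then T (i # x) * T (j # y) * T (k # z) else 0)"
      unfolding compatible_def by (intro sum.cong refl) simp
    finally show ?thesis .
  qed
  have summand: "(if w m p q r s = 0 then 0
      else of_nat (w m p q r s) * t3 n m T i j k (int p) (int q) (int r) (int s)
        / (trinomial ?M s r * trinomial ?M p (q + s - p) * trinomial ?M q (r + s - p)))
      = (\<Sum>x\<in>?X. \<Sum>y\<in>?X. \<Sum>z\<in>?X. if compatible m i j k p q r s x y z then ?v x y z else 0)"
    (is "?l = _") for p q r s
  proof -
    \<comment> \<open>If \<open>w\<close> is zero, both sides vanish, so the case distinction
      disappears.\<close>
    have "?l = of_nat (w m p q r s) * ?c p q r s * t3 n m T i j k (int p) (int q) (int r) (int s)"
      by simp
    also have "\<dots> = (\<Sum>x\<in>?X. \<Sum>y\<in>?X. \<Sum>z\<in>?X. of_nat (w m p q r s) * ?c p q r s *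
        (if compatible m i j k p q r s x y z then T (i # x) * T (j # y) * T (k # z) else 0))"
      unfolding t3 sum_distrib_left ..
    also have "\<dots> = (\<Sum>x\<in>?X. \<Sum>y\<in>?X. \<Sum>z\<in>?X. if compatible m i j k p q r s x y z then ?v x y z else 0)"
    proof (intro sum.cong refl)
      fix x y z
      show "of_nat (w m p q r s) * ?c p q r s *
          (if compatible m i j k p q r s x y z then T (i # x) * T (j # y) * T (k # z) else 0)
        = (if compatible m i j k p q r s x y z then ?v x y z else 0)"
      proof (cases "compatible m i j k p q r s x y z")
        case True
        show ?thesis
          unfolding trinomial_compatible[OF ijk True] walk_weight_compatible[OF ijk True]
          using True by (simp add: mult_ac)
      qed simp
    qed
    finally show ?thesis .
  qed
  \<comment> \<open>A nonzero term belongs to exactly one quadruple of parameters, namely four of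
    its arc multiplicities.\<close>
  have collect: "?v x y z = (\<Sum>p=0..?M. \<Sum>q=0..?M. \<Sum>r=0..?M. \<Sum>s=0..?M.
      if compatible m i j k p q r s x y z then ?v x y z else 0)"
    if "x \<in> ?X" "y \<in> ?X" "z \<in> ?X" for x y z
  proof (rule sum_unique4[symmetric])
    \<comment> \<open>Multiplicities are bounded by the tuple length, so these parameters lie in the
      summation range.\<close>
    have "count (mset y) v \<le> ?M" if "y \<in> ?X" for v y
      using count_le_size[of "mset y" v] tuples_length[OF that] by simp
    then show "count (mset x) j \<in> {0..?M}" "count (mset y) k \<in> {0..?M}"
      "count (mset z) i \<in> {0..?M}" "count (mset y) i \<in> {0..?M}"
      using that by auto
    fix p q r s assume "?v x y z \<noteq> 0"
    then have "walk_weight (arcs_from i x + arcs_from j y + arcs_from k z) \<noteq> 0"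
      by auto
    from balanced_compatible[OF ijk m _ _ _ this] that
    have "compatible m i j k (count (mset x) j) (count (mset y) k) (count (mset z) i) (count (mset y) i) x y z"
      by (simp add: tuples_length)
    then show "compatible m i j k p q r s x y z \<longleftrightarrow> p = count (mset x) j \<and> q = count (mset y) k \<and>
        r = count (mset z) i \<and> s = count (mset y) i"
      using compatible_iff_count[OF ijk] by metis
  qed simp
  have "trace3 n m T i j k / fact ?M ^ 3 = (\<Sum>x\<in>?X. \<Sum>y\<in>?X. \<Sum>z\<in>?X. ?v x y z)"
    unfolding trace3_def by (simp add: sum_divide_distrib)
  also have "\<dots> = (\<Sum>x\<in>?X. \<Sum>y\<in>?X. \<Sum>z\<in>?X. \<Sum>p=0..?M. \<Sum>q=0..?M. \<Sum>r=0..?M. \<Sum>s=0..?M.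
      if compatible m i j k p q r s x y z then ?v x y z else 0)"
    by (intro sum.cong refl collect)
  also have "\<dots> = (\<Sum>p=0..?M. \<Sum>q=0..?M. \<Sum>r=0..?M. \<Sum>s=0..?M. \<Sum>x\<in>?X. \<Sum>y\<in>?X. \<Sum>z\<in>?X.
      if compatible m i j k p q r s x y z then ?v x y z else 0)"
    by (simp only: sum.swap[of _ "{0..?M}" ?X])
  finally show ?thesis
    unfolding summand .
qed

theorem theorem5p2:
  fixes m n :: nat and T :: "nat list \<Rightarrow> complex"
  assumes "m \<ge> 2" and "n \<ge> 1"
  shows "Tr n m T 3 / of_nat (m - 1) ^ (n - 1) =
      (\<Sum>i=1..n. T (replicate m i) ^ 3)
    + (\<Sum>(i, j) | i \<in> {1..n} \<and> j \<in> {1..n} \<and> i \<noteq> j. \<Sum>s=0..m - 1.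
         of_nat (3 * s) / of_nat (2 * (m - 1))
         * entry_pair_sum n m T i [(j, int s), (i, 2 * (int m - 1) - int s)]
         * entry_sum n m T j [(i, int s), (j, int m - 1 - int s)])
    + (\<Sum>(i, j, k) | i \<in> {1..n} \<and> j \<in> {1..n} \<and> k \<in> {1..n} \<and> i < j \<and> j < k.
         \<Sum>p=0..m - 1. \<Sum>q=0..m - 1. \<Sum>r=0..m - 1. \<Sum>s=0..m - 1.
           if w m p q r s = 0 then 0
           else of_nat (w m p q r s) * t3 n m T i j k (int p) (int q) (int r) (int s)
                / (trinomial (m - 1) s r * trinomial (m - 1) p (q + s - p)
                   * trinomial (m - 1) q (r + s - p)))"
  unfolding Tr3_eq_sum_trace3[OF assms(1)]
proof (intro arg_cong2[where f = "(+)"] sum.cong refl, goal_cases)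
  case (1 i)
  then show ?case
    using assms by (intro trace3_same) auto
next
  case (2 x)
  then show ?case
    using trace3_two[OF assms(1)] by (cases x) auto
next
  case (3 x)
  then obtain i j k where x: "x = (i, j, k)" "i \<noteq> j" "i \<noteq> k" "j \<noteq> k"
    by (cases x) auto
  show ?case
    unfolding x(1) case_prod_conv by (rule trace3_distinct[OF assms(1) x(2-4)])
qed

end
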